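(* For $n\ge 2^{19}$, let $\mathcal{F}$ be a $1$-intersecting family of spanning trees of $K_n$. Then \[ |\mathcal{F}| \leq 2n^{n-3} + (n-2). \] Moreover, equality holds if and only if $\mathcal{F}$ consists of all $n$ stars together with all spanning trees containing one fixed edge.
   Context: $K_n$ is the complete graph on vertex set $[n]$. Spanning trees are identified with their edge sets. A family of spanning trees is $1$-intersecting if every two members share at least one edge. A star is a spanning tree of $K_n$ having a vertex of degree $n-1$ (there are exactly $n$ of them). *)

theory Defs
  imports Main
begin

definition Kn_edges :: "nat \<Rightarrow> nat set set" where
  "Kn_edges n = {{u, v} | u v. u \<in> {1..n} \<and> v \<in> {1..n} \<and> u \<noteq> v}"

definition adj :: "nat set set \<Rightarrow> nat \<Rightarrow> nat \<Rightarrow> bool" where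
  "adj T u v \<longleftrightarrow> {u, v} \<in> T \<and> u \<noteq> v"

definition connected_on :: "nat \<Rightarrow> nat set set \<Rightarrow> bool" where
  "connected_on n T \<longleftrightarrow> (\<forall>u\<in>{1..n}. \<forall>v\<in>{1..n}. (adj T)\<^sup>*\<^sup>* u v)"

definition is_cycle :: "nat set set \<Rightarrow> nat list \<Rightarrow> bool" where
  "is_cycle T cs \<longleftrightarrow> length cs \<ge> 3 \<and> distinct cs
     \<and> (\<forall>i. Suc i < length cs \<longrightarrow> adj T (cs ! i) (cs ! Suc i))
     \<and> adj T (last cs) (hd cs)"

definition acyclic_graph :: "nat set set \<Rightarrow> bool" where
  "acyclic_graph T \<longleftrightarrow> (\<nexists>cs. is_cycle T cs)"

definition spanning_tree :: "nat \<Rightarrow> nat set set \<Rightarrow> bool" where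
  "spanning_tree n T \<longleftrightarrow> T \<subseteq> Kn_edges n \<and> connected_on n T \<and> acyclic_graph T"

definition spanning_trees :: "nat \<Rightarrow> nat set set set" where
  "spanning_trees n = {T. spanning_tree n T}"

definition degree :: "nat set set \<Rightarrow> nat \<Rightarrow> nat" where
  "degree T v = card {e \<in> T. v \<in> e}"

definition is_star :: "nat \<Rightarrow> nat set set \<Rightarrow> bool" where
  "is_star n T \<longleftrightarrow> spanning_tree n T \<and> (\<exists>v\<in>{1..n}. degree T v = n - 1)"

definition stars :: "nat \<Rightarrow> nat set set set" where
  "stars n = {T. is_star n T}"

definition intersecting_1 :: "nat set set set \<Rightarrow> bool" where
  "intersecting_1 F \<longleftrightarrow> (\<forall>S\<in>F. \<forall>T\<in>F. S \<inter> T \<noteq> {})"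

end

theory Submission
  imports Defs Complex_Main "HOL-Library.FuncSet" "HOL-Library.Transitive_Closure_Table"
begin

text \<open>Write \<open>F(S)\<close> for the members of \<open>F\<close> containing \<open>S\<close>. At most \<open>(2/n)^|S| n^(n-2)\<close> spanning trees
  contain \<open>S\<close>. Put \<open>r = 2/3 sqrt n\<close> and choose \<open>S\<close> maximizing \<open>|F(S)| r^|S|\<close>; then the link of \<open>S\<close> in \<open>F\<close> is
  \<open>r\<close>-spread, and if \<open>|F| \<ge> 2 n^(n-3)\<close> the counting bound leaves only \<open>S = {}\<close> or \<open>S = {e}\<close>. Two spread
  families contain disjoint members: in a random colouring of the edges, each family has a member inside
  its own half of the colours with probability above 1/2. This excludes \<open>S = {}\<close>. Applied to the members
  containing \<open>e\<close> and to a spread link among the members avoiding \<open>e\<close>, it shows that fewer than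
  \<open>n^(n-9)\<close> members avoid \<open>e\<close>. A member \<open>T\<close> avoiding \<open>e\<close> that is not a star is disjoint from more than
  \<open>n^(n-9)\<close> trees containing \<open>e\<close>, because a common edge can be exchanged across its cut for an edge
  outside \<open>T\<close>; losing those trees costs more than all members avoiding \<open>e\<close> can gain. So these members are
  stars.\<close>

section \<open>Spread families\<close>

text \<open>Two demands fix \<open>r\<close>. A set \<open>S\<close> of two edges must fall below
  the bound \<open>2 n^(n-3)\<close>, that is \<open>(2 r / n)^2 < 2 / n\<close>; and the members
  containing \<open>e\<close>, at least a fraction \<open>1 / r\<close> of \<open>F\<close>, must be
  spread by the counting bound alone, with room to discard those meeting a bounded set. Both say
  \<open>r^2 < n / 2\<close>, and \<open>2/3\<close> is a rational a little below
  \<open>1 / sqrt 2\<close>. Members have fewer than \<open>n = 9/4 r^2\<close> edges, so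
  \<open>r\<close> is a power of their size. Exposing one colour class shrinks the uncovered rest by
  a factor of about \<open>r / 80\<close>, hence a constant number of rounds suffices and no
  logarithm is lost. Eight rounds for each of two families make 16 colours, and
  \<open>n >= 2^19\<close> gives the \<open>r >= 482\<close> with which these rounds are computed.
  The obstacle in iterating is that the rests of different members may coincide, and that they must
  be compared with the spread family at the start. They are therefore indexed by the original
  members throughout and counted with multiplicity. The exponent \<open>n - 9\<close> is
  \<open>n - 3\<close>, from the number of trees containing \<open>e\<close>, lowered by 6, the cost
  of recording up to three lost and three gained edges.\<close>

definition spread :: "real \<Rightarrow> 'a set set \<Rightarrow> bool" where
  "spread r A \<longleftrightarrow> (\<forall>S. finite S \<longrightarrow> real (card {T \<in> A. S \<subseteq> T}) * r ^ card S \<le> real (card A))"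

text \<open>The minimum fragments of Park and Pham, for an indexed family instead of a set of sets.
  For \<open>i\<close> in \<open>I\<close> the index \<open>i\<close> itself is a candidate, so the
  minimum is attained.\<close>

definition witness :: "'a set \<Rightarrow> 'i set \<Rightarrow> ('i \<Rightarrow> 'a set) \<Rightarrow> 'i \<Rightarrow> 'i" where
  "witness W I h i = (ARG_MIN (\<lambda>j. card (h j - W)) j. j \<in> I \<and> h j \<subseteq> W \<union> h i)"

definition fragment :: "'a set \<Rightarrow> 'i set \<Rightarrow> ('i \<Rightarrow> 'a set) \<Rightarrow> 'i \<Rightarrow> 'a set" where
  "fragment W I h i = h (witness W I h i) - W"

lemma witness:
  assumes "i \<in> I"
  shows "witness W I h i \<in> I" "h (witness W I h i) \<subseteq> W \<union> h i"
    and "j \<in> I \<Longrightarrow> h j \<subseteq> W \<union> h i \<Longrightarrow> card (fragment W I h i) \<le> card (h j - W)"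
proof -
  let ?P = "\<lambda>j. j \<in> I \<and> h j \<subseteq> W \<union> h i"
  have P: "?P i" using assms by auto
  from arg_min_nat_lemma[where P = ?P, OF P, where m = "\<lambda>j. card (h j - W)"]
  show "witness W I h i \<in> I" "h (witness W I h i) \<subseteq> W \<union> h i"
    and "j \<in> I \<Longrightarrow> h j \<subseteq> W \<union> h i \<Longrightarrow> card (fragment W I h i) \<le> card (h j - W)"
    unfolding witness_def fragment_def by auto
qed

lemma fragment_subset: "i \<in> I \<Longrightarrow> fragment W I h i \<subseteq> h i - W"
  using witness(2)[of i I h W] unfolding fragment_def by auto

section \<open>Sums of powers over the subsets of a finite set\<close>

lemma sum_Pow_power:
  fixes x :: real
  assumes "finite A"
  shows "(\<Sum>S\<in>Pow A. x ^ card S) = (1 + x) ^ card A"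
proof -
  have "(\<Sum>S\<in>Pow A. x ^ card S) = (\<Sum>S\<in>Pow A. (\<Prod>i\<in>S. x) * (\<Prod>i\<in>A-S. 1))" by simp
  also have "\<dots> = (\<Prod>i\<in>A. x + 1)" using prod_add[OF assms, of "\<lambda>_. x" "\<lambda>_. 1"] by simp
  finally show ?thesis by (simp add: add.commute)
qed

lemma sum_large_subsets_le:
  fixes y z :: real
  assumes "finite A" "card A \<le> k" "0 \<le> y" "1 \<le> z"
  shows "(\<Sum>S | S \<subseteq> A \<and> m \<le> card S. y ^ card S) \<le> (1 + y * z) ^ k / z ^ m"
proof -
  have "(\<Sum>S | S \<subseteq> A \<and> m \<le> card S. y ^ card S) \<le> (\<Sum>S | S \<subseteq> A \<and> m \<le> card S. (y * z) ^ card S / z ^ m)"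
  proof (rule sum_mono)
    fix S assume "S \<in> {S. S \<subseteq> A \<and> m \<le> card S}"
    then have "z ^ m \<le> z ^ card S" using assms by (auto intro: power_increasing)
    then have "y ^ card S * z ^ m \<le> y ^ card S * z ^ card S" using assms by (intro mult_left_mono) auto
    then show "y ^ card S \<le> (y * z) ^ card S / z ^ m"
      using assms by (simp add: power_mult_distrib pos_le_divide_eq)
  qed
  also have "\<dots> \<le> (\<Sum>S\<in>Pow A. (y * z) ^ card S / z ^ m)"
    using assms by (intro sum_mono2) auto
  also have "\<dots> = (1 + y * z) ^ card A / z ^ m"
    using assms by (simp add: sum_Pow_power flip: sum_divide_distrib)
  also have "\<dots> \<le> (1 + y * z) ^ k / z ^ m"
    using assms by (intro divide_right_mono power_increasing) auto
  finally show ?thesis .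
qed

text \<open>For the last round, where every nonempty fragment is bad: the tilted bound with
  \<open>m = 1\<close> would be too large there.\<close>

lemma sum_nonempty_subsets_le:
  fixes y :: real
  assumes "finite A" "card A \<le> k" "0 \<le> y"
  shows "(\<Sum>S | S \<subseteq> A \<and> 1 \<le> card S. y ^ card S) \<le> (1 + y) ^ k - 1"
proof -
  have "{S. S \<subseteq> A \<and> 1 \<le> card S} = Pow A - {{}}"
    using assms finite_subset by (fastforce simp: Suc_le_eq card_gt_0_iff)
  then have "(\<Sum>S | S \<subseteq> A \<and> 1 \<le> card S. y ^ card S) = (1 + y) ^ card A - 1"
    using assms by (simp add: sum_diff1 sum_Pow_power)
  also have "\<dots> \<le> (1 + y) ^ k - 1"
    using assms by (simp add: power_increasing)
  finally show ?thesis .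
qed

text \<open>The map sending a bad pair \<open>(c, i)\<close> to the colouring that gives the whole fragment of \<open>i\<close>
  the colour \<open>s\<close> is almost injective: by minimality the fragment is contained in \<^emph>\<open>every\<close>
  member covered by the enlarged colour class, in particular in a canonical one.\<close>
lemma bad_pairs_le:
  fixes I :: "('a \<Rightarrow> nat) \<Rightarrow> 'i set" and h :: "('a \<Rightarrow> nat) \<Rightarrow> 'i \<Rightarrow> 'a set"
  assumes X: "finite X" and s: "s < q" "s \<notin> U" and r: "r > 0"
    and dep: "\<And>c c'. (\<And>x. x \<in> X \<Longrightarrow> c x \<in> U \<or> c' x \<in> U \<Longrightarrow> c x = c' x) \<Longrightarrow> I c = I c' \<and> h c = h c'"
    and fin: "\<And>c. c \<in> X \<rightarrow>\<^sub>E {..<q} \<Longrightarrow> finite (I c)"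
    and sub: "\<And>c i. c \<in> X \<rightarrow>\<^sub>E {..<q} \<Longrightarrow> i \<in> I c \<Longrightarrow> h c i \<subseteq> {x \<in> X. c x \<notin> U}"
    and spr: "\<And>c S. c \<in> X \<rightarrow>\<^sub>E {..<q} \<Longrightarrow> finite S \<Longrightarrow> real (card {i \<in> I c. S \<subseteq> h c i}) * r ^ card S \<le> L"
    and B: "\<And>c i. c \<in> X \<rightarrow>\<^sub>E {..<q} \<Longrightarrow> i \<in> I c
              \<Longrightarrow> (\<Sum>S | S \<subseteq> h c i \<and> m \<le> card S. (real q / r) ^ card S) \<le> B"
    and B0: "B \<ge> 0" and L0: "L \<ge> 0"
  shows "real (card (SIGMA c: X \<rightarrow>\<^sub>E {..<q}. {i \<in> I c. m \<le> card (fragment {x \<in> X. c x = s} (I c) (h c) i)}))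
          \<le> real q ^ card X * (L * B)"
proof -
  let ?C = "X \<rightarrow>\<^sub>E {..<q}"
  let ?W = "\<lambda>c. {x \<in> X. c x = s}"
  let ?fr = "\<lambda>c. fragment (?W c) (I c) (h c)"
  let ?Bad = "SIGMA c: ?C. {i \<in> I c. m \<le> card (?fr c i)}"
  \<comment> \<open>The choice depends on \<open>c\<close> alone. Once the recoloured map is known,
    \<open>S\<close> ranges only over subsets of this one set, before \<open>i\<close> is
    named.\<close>
  define can where "can c = (SOME i. i \<in> I c \<and> h c i \<subseteq> ?W c)" for c
  define Sets where "Sets c = (if \<exists>i. i \<in> I c \<and> h c i \<subseteq> ?W c then {S. S \<subseteq> h c (can c) \<and> m \<le> card S} else {})" for c
  define rc where "rc c S = (\<lambda>x. if x \<in> S then s else c x)" for c :: "'a \<Rightarrow> nat" and S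
  \<comment> \<open>Codes for bad pairs: recoloured map, fragment, old colours on the fragment,
    index. For given \<open>S\<close> there are \<open>q ^ card S\<close> old colourings and at most
    \<open>L / r ^ card S\<close> indices.\<close>
  let ?T = "SIGMA c: ?C. SIGMA S: Sets c. (S \<rightarrow>\<^sub>E {..<q}) \<times> {i \<in> I c. S \<subseteq> h c i}"
  define \<phi> where "\<phi> p = (let c = fst p; i = snd p; S = ?fr c i in (rc c S, S, restrict c S, i))" for p
  have finC: "finite ?C" using X by (intro finite_PiE) auto
  have can: "can c \<in> I c \<and> h c (can c) \<subseteq> ?W c" if "\<exists>i. i \<in> I c \<and> h c i \<subseteq> ?W c" for c
    unfolding can_def using someI_ex[OF that] by simp
  have finh: "finite (h c i)" if "c \<in> ?C" "i \<in> I c" for c i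
    by (rule finite_subset[OF sub[OF that]]) (use X in simp)
  have finS: "finite (Sets c)" if "c \<in> ?C" for c
    using can[of c] finh[OF that] by (auto simp: Sets_def)
  have fS: "finite S" if "c \<in> ?C" "S \<in> Sets c" for c S
  proof -
    have "\<exists>i. i \<in> I c \<and> h c i \<subseteq> ?W c" "S \<subseteq> h c (can c)"
      using that by (auto simp: Sets_def split: if_splits)
    then show ?thesis using can finh[OF that(1)] finite_subset by blast
  qed
  have inj: "inj_on \<phi> ?Bad"
  proof (rule inj_onI)
    fix p p' assume p: "p \<in> ?Bad" "p' \<in> ?Bad" and eq: "\<phi> p = \<phi> p'"
    obtain c i c' i' where pp: "p = (c, i)" "p' = (c', i')" by fastforce
    have e: "rc c (?fr c i) = rc c' (?fr c' i')" "?fr c i = ?fr c' i'" "restrict c (?fr c i) = restrict c' (?fr c' i')" "i = i'"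
      using eq unfolding \<phi>_def pp Let_def by auto
    have "c = c'"
    proof
      fix x show "c x = c' x"
      proof (cases "x \<in> ?fr c i")
        case True then show ?thesis using e(2) fun_cong[OF e(3), of x] by (simp add: restrict_def)
      next
        case False then show ?thesis using e(2) fun_cong[OF e(1), of x] by (simp add: rc_def)
      qed
    qed
    then show "p = p'" using pp e by simp
  qed
  have im: "\<phi> ` ?Bad \<subseteq> ?T"
  proof
    fix t assume "t \<in> \<phi> ` ?Bad"
    then obtain p where p: "p \<in> ?Bad" and tp: "t = \<phi> p" by blast
    obtain c i where pe: "p = (c, i)" by (cases p)
    have c: "c \<in> ?C" and i: "i \<in> I c" and m: "m \<le> card (?fr c i)" using p unfolding pe by auto
    have t: "t = \<phi> (c, i)" using tp pe by simp
    define S where "S = ?fr c i"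
    have Sh: "S \<subseteq> h c i - ?W c" unfolding S_def by (rule fragment_subset[OF i])
    have SX: "S \<subseteq> {x \<in> X. c x \<notin> U}" using Sh sub[OF c i] by auto
    define c' where "c' = rc c S"
    have c': "c' \<in> ?C" using c SX s unfolding c'_def rc_def by (auto simp: PiE_iff extensional_def)
    \<comment> \<open>Elements of \<open>S\<close> have colours outside \<open>U\<close> and receive
      \<open>s\<close>, also outside \<open>U\<close>, so the family does not notice the
      recolouring.\<close>
    have "I c = I c' \<and> h c = h c'"
      by (rule dep) (use SX s in \<open>auto simp: c'_def rc_def split: if_splits\<close>)
    then have Ih: "I c' = I c" "h c' = h c" by auto
    have W': "?W c' = ?W c \<union> S" using SX unfolding c'_def rc_def by auto
    let ?w = "witness (?W c) (I c) (h c) i"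
    have wI: "?w \<in> I c" by (rule witness[OF i])
    have wW: "h c ?w \<subseteq> ?W c'" unfolding W' S_def fragment_def by blast
    have ex: "\<exists>i. i \<in> I c' \<and> h c' i \<subseteq> ?W c'"
      unfolding Ih using wI wW by blast
    let ?j = "can c'"
    have j: "?j \<in> I c" "h c ?j \<subseteq> ?W c \<union> S" using can[OF ex] unfolding Ih W' by auto
    \<comment> \<open>So \<open>?j\<close> was a competitor when the witness of \<open>i\<close> was
      chosen, and its part outside the old class has at least \<open>card S\<close> elements. That
      part lies inside \<open>S\<close>, hence equals \<open>S\<close>.\<close>
    have "h c ?j \<subseteq> ?W c \<union> h c i" using j Sh by auto
    then have "card S \<le> card (h c ?j - ?W c)" unfolding S_def using witness(3)[OF i] j(1) by blast
    moreover have "h c ?j - ?W c \<subseteq> S" using j by auto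
    moreover have "finite S" using Sh finh[OF c i] by (meson finite_Diff finite_subset)
    ultimately have "h c ?j - ?W c = S" by (simp add: card_seteq)
    then have "S \<subseteq> h c ?j" by auto
    then have "S \<in> Sets c'" using ex m unfolding Sets_def Ih S_def by auto
    moreover have "restrict c S \<in> S \<rightarrow>\<^sub>E {..<q}" using c SX by (auto simp: PiE_iff)
    moreover have "i \<in> {i \<in> I c'. S \<subseteq> h c' i}" using i Sh Ih by auto
    moreover have "t = (c', S, restrict c S, i)" unfolding t \<phi>_def Let_def c'_def S_def by simp
    ultimately show "t \<in> ?T" using c' by auto
  qed
  have finP: "finite ((S \<rightarrow>\<^sub>E {..<q}) \<times> {i \<in> I c. S \<subseteq> h c i})"
    if "c \<in> ?C" "S \<in> Sets c" for c S
  proof (rule finite_cartesian_product)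
    show "finite (S \<rightarrow>\<^sub>E {..<q})" by (rule finite_PiE[OF fS[OF that]]) simp
    show "finite {i \<in> I c. S \<subseteq> h c i}" using fin[OF that(1)] by simp
  qed
  have finI: "finite (SIGMA S: Sets c. (S \<rightarrow>\<^sub>E {..<q}) \<times> {i \<in> I c. S \<subseteq> h c i})"
    if "c \<in> ?C" for c
    by (rule finite_SigmaI[OF finS[OF that] finP[OF that]])
  then have finT: "finite ?T" by (rule finite_SigmaI[OF finC])
  have "card ?Bad \<le> card ?T" by (rule card_inj_on_le[OF inj im finT])
  then have "real (card ?Bad) \<le> real (card ?T)" by simp
  also have "\<dots> = (\<Sum>c\<in>?C. \<Sum>S\<in>Sets c. real (q ^ card S * card {i \<in> I c. S \<subseteq> h c i}))"
  proof -
    have "card ?T = (\<Sum>c\<in>?C. card (SIGMA S: Sets c. (S \<rightarrow>\<^sub>E {..<q}) \<times> {i \<in> I c. S \<subseteq> h c i}))"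
      by (rule card_SigmaI[OF finC]) (use finI in blast)
    also have "\<dots> = (\<Sum>c\<in>?C. \<Sum>S\<in>Sets c. card ((S \<rightarrow>\<^sub>E {..<q}) \<times> {i \<in> I c. S \<subseteq> h c i}))"
      by (intro sum.cong refl card_SigmaI finS) (use finP in blast)+
    also have "\<dots> = (\<Sum>c\<in>?C. \<Sum>S\<in>Sets c. q ^ card S * card {i \<in> I c. S \<subseteq> h c i})"
      using fS by (intro sum.cong refl) (simp add: card_cartesian_product card_PiE)
    finally show ?thesis by simp
  qed
  also have "\<dots> \<le> (\<Sum>c\<in>?C. \<Sum>S\<in>Sets c. L * (real q / r) ^ card S)"
  proof (intro sum_mono)
    fix c S assume c: "c \<in> ?C" and S: "S \<in> Sets c"
    have "finite S" by (rule fS[OF c S])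
    then have "real (card {i \<in> I c. S \<subseteq> h c i}) \<le> L / r ^ card S"
      using spr[OF c] r by (simp add: pos_le_divide_eq)
    then have "real q ^ card S * real (card {i \<in> I c. S \<subseteq> h c i}) \<le> real q ^ card S * (L / r ^ card S)"
      by (intro mult_left_mono) auto
    then show "real (q ^ card S * card {i \<in> I c. S \<subseteq> h c i}) \<le> L * (real q / r) ^ card S"
      by (simp add: power_divide mult.commute)
  qed
  also have "\<dots> \<le> (\<Sum>c\<in>?C. L * B)"
  proof (intro sum_mono)
    fix c assume c: "c \<in> ?C"
    have "(\<Sum>S\<in>Sets c. (real q / r) ^ card S) \<le> B"
      using B[OF c] can[of c] B0 by (auto simp: Sets_def)
    then show "(\<Sum>S\<in>Sets c. L * (real q / r) ^ card S) \<le> L * B"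
      using L0 by (simp add: mult_left_mono flip: sum_distrib_left)
  qed
  also have "\<dots> = real q ^ card X * (L * B)" using X by (simp add: card_PiE)
  finally show ?thesis .
qed


text \<open>A state is a set of surviving indices together with the uncovered rest attached to each
  index. Round \<open>j\<close> exposes the class of colour \<open>\<sigma> j\<close>, replaces
  rests by fragments and drops the indices whose fragment exceeds the cap
  \<open>k (Suc j)\<close>.\<close>

primrec stage :: "(nat \<Rightarrow> nat) \<Rightarrow> (nat \<Rightarrow> nat) \<Rightarrow> 'a set \<Rightarrow> 'a set set \<Rightarrow> ('a \<Rightarrow> nat) \<Rightarrow> nat
    \<Rightarrow> 'a set set \<times> ('a set \<Rightarrow> 'a set)" where
  "stage \<sigma> k X A c 0 = (A, \<lambda>T. T)"
| "stage \<sigma> k X A c (Suc j) =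
    (let I = fst (stage \<sigma> k X A c j); h = fragment {x \<in> X. c x = \<sigma> j} I (snd (stage \<sigma> k X A c j))
     in ({i \<in> I. card (h i) \<le> k (Suc j)}, h))"

text \<open>The first \<open>j\<close> rounds look only at the classes of their own colours. This
  supplies the independence that the recolouring argument requires.\<close>

lemma stage_cong:
  "(\<And>x. x \<in> X \<Longrightarrow> c x \<in> \<sigma> ` {..<j} \<or> c' x \<in> \<sigma> ` {..<j} \<Longrightarrow> c x = c' x)
    \<Longrightarrow> stage \<sigma> k X A c j = stage \<sigma> k X A c' j"
proof (induction j)
  case (Suc j)
  have "stage \<sigma> k X A c j = stage \<sigma> k X A c' j"
    by (rule Suc.IH, rule Suc.prems) (auto simp: lessThan_Suc)
  moreover have "{x \<in> X. c x = \<sigma> j} = {x \<in> X. c' x = \<sigma> j}"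
  proof -
    have "c x = \<sigma> j \<longleftrightarrow> c' x = \<sigma> j" if "x \<in> X" for x
      using Suc.prems[OF that] by (auto simp: lessThan_Suc)
    then show ?thesis by auto
  qed
  ultimately show ?case by simp
qed simp

text \<open>Rests stay inside their index, so the spread bound of \<open>A\<close> applies to them
  with multiplicity. The last conjunct is the goal of the process: an empty rest means that a member
  of \<open>A\<close> is covered by the exposed classes.\<close>

lemma stage_invariant:
  assumes A: "A \<subseteq> Pow X" and k: "\<And>T. T \<in> A \<Longrightarrow> card T \<le> k 0"
    and i: "i \<in> fst (stage \<sigma> k X A c j)"
  shows "i \<in> A \<and> snd (stage \<sigma> k X A c j) i \<subseteq> i
    \<and> snd (stage \<sigma> k X A c j) i \<subseteq> {x \<in> X. c x \<notin> \<sigma> ` {..<j}}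
    \<and> card (snd (stage \<sigma> k X A c j) i) \<le> k j
    \<and> (\<exists>T\<in>A. T \<subseteq> {x \<in> X. c x \<in> \<sigma> ` {..<j}} \<union> snd (stage \<sigma> k X A c j) i)"
  using i
proof (induction j arbitrary: i)
  case 0
  then show ?case using A k by auto
next
  case (Suc j)
  let ?I = "fst (stage \<sigma> k X A c j)" and ?h = "snd (stage \<sigma> k X A c j)"
  let ?W = "{x \<in> X. c x = \<sigma> j}"
  let ?w = "witness ?W ?I ?h i"
  have i: "i \<in> ?I" and ki: "card (fragment ?W ?I ?h i) \<le> k (Suc j)"
    using Suc.prems by (auto simp: Let_def)
  have h': "snd (stage \<sigma> k X A c (Suc j)) i = ?h ?w - ?W"
    by (simp add: Let_def fragment_def)
  have sub: "?h ?w - ?W \<subseteq> ?h i"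
    using fragment_subset[OF i, of ?W ?h] by (auto simp: fragment_def)
  \<comment> \<open>The covered member comes from the witness, which is itself a surviving index;
    the inclusion in \<open>i\<close> comes from \<open>i\<close>.\<close>
  note IHi = Suc.IH[OF i] and IHw = Suc.IH[OF witness(1)[OF i, of ?W ?h]]
  obtain T where T: "T \<in> A" "T \<subseteq> {x \<in> X. c x \<in> \<sigma> ` {..<j}} \<union> ?h ?w"
    using IHw by blast
  have "T \<subseteq> {x \<in> X. c x \<in> \<sigma> ` {..<Suc j}} \<union> (?h ?w - ?W)"
    using T by (auto simp: lessThan_Suc)
  moreover have "?h ?w - ?W \<subseteq> {x \<in> X. c x \<notin> \<sigma> ` {..<Suc j}}"
    using IHw by (auto simp: lessThan_Suc)
  ultimately show ?case
    unfolding h' using IHi sub ki T(1) by (auto simp: fragment_def)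
qed

text \<open>An index lost in a round forms a bad pair with the colouring. Every round is measured
  against the whole of \<open>A\<close>, never against the survivors, so the losses simply add
  up.\<close>

lemma stage_loss:
  assumes X: "finite X" and A: "A \<subseteq> Pow X" and k: "\<And>T. T \<in> A \<Longrightarrow> card T \<le> k 0"
    and spr: "spread r A" and r: "r > 0"
    and \<sigma>: "inj_on \<sigma> {..<J}" "\<sigma> ` {..<J} \<subseteq> {..<q}"
    and B: "\<And>j H. j < J \<Longrightarrow> H \<subseteq> X \<Longrightarrow> card H \<le> k j
              \<Longrightarrow> (\<Sum>S | S \<subseteq> H \<and> Suc (k (Suc j)) \<le> card S. (real q / r) ^ card S) \<le> B j"
    and B0: "\<And>j. B j \<ge> 0"
  shows "j \<le> J \<Longrightarrow> real (\<Sum>c\<in>X \<rightarrow>\<^sub>E {..<q}. card (A - fst (stage \<sigma> k X A c j)))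
           \<le> real q ^ card X * card A * (\<Sum>i<j. B i)"
proof (induction j)
  case (Suc j)
  let ?C = "X \<rightarrow>\<^sub>E {..<q}"
  let ?I = "\<lambda>c. fst (stage \<sigma> k X A c j)" and ?h = "\<lambda>c. snd (stage \<sigma> k X A c j)"
  let ?Bad = "\<lambda>c. {i \<in> ?I c. Suc (k (Suc j)) \<le> card (fragment {x \<in> X. c x = \<sigma> j} (?I c) (?h c) i)}"
  have finA: "finite A" using X A by (meson finite_Pow_iff finite_subset)
  have finC: "finite ?C" using X by (intro finite_PiE) auto
  have inv: "i \<in> A" "?h c i \<subseteq> i" "?h c i \<subseteq> {x \<in> X. c x \<notin> \<sigma> ` {..<j}}" "card (?h c i) \<le> k j"
    if "i \<in> ?I c" for c i
    using stage_invariant[where k = k and A = A, OF A _ that] k by simp_all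
  have subA: "?I c \<subseteq> A" for c using inv(1) by blast
  have finI: "finite (?I c)" for c using subA finA finite_subset by blast
  have "A - fst (stage \<sigma> k X A c (Suc j)) \<subseteq> (A - ?I c) \<union> ?Bad c" for c
    by (auto simp: Let_def)
  then have "card (A - fst (stage \<sigma> k X A c (Suc j))) \<le> card ((A - ?I c) \<union> ?Bad c)" for c
    using finA finI by (intro card_mono) auto
  then have le: "card (A - fst (stage \<sigma> k X A c (Suc j))) \<le> card (A - ?I c) + card (?Bad c)" for c
    using card_Un_le order_trans by blast
  have finB: "finite (?Bad c)" for c using finI by simp
  have bad: "real (card (SIGMA c: ?C. ?Bad c)) \<le> real q ^ card X * (card A * B j)"
  proof (rule bad_pairs_le[OF X _ _ r, where U = "\<sigma> ` {..<j}"])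
    show "\<sigma> j < q" using \<sigma> Suc.prems by (auto simp: image_subset_iff)
    show "\<sigma> j \<notin> \<sigma> ` {..<j}" using inj_on_image_mem_iff[OF \<sigma>(1), of j "{..<j}"] Suc.prems by auto
    show "?I c = ?I c' \<and> ?h c = ?h c'"
      if "\<And>x. x \<in> X \<Longrightarrow> c x \<in> \<sigma> ` {..<j} \<or> c' x \<in> \<sigma> ` {..<j} \<Longrightarrow> c x = c' x" for c c'
    proof -
      have "stage \<sigma> k X A c j = stage \<sigma> k X A c' j" by (rule stage_cong[OF that])
      then show ?thesis by simp
    qed
    show "finite (?I c)" for c by (rule finI)
    show "?h c i \<subseteq> {x \<in> X. c x \<notin> \<sigma> ` {..<j}}" if "i \<in> ?I c" for c i
      by (rule inv(3)[OF that])
    show "real (card {i \<in> ?I c. S \<subseteq> ?h c i}) * r ^ card S \<le> real (card A)" if "finite S" for c S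
    proof -
      have "{i \<in> ?I c. S \<subseteq> ?h c i} \<subseteq> {T \<in> A. S \<subseteq> T}" using inv(1,2)[of _ c] by blast
      then have "card {i \<in> ?I c. S \<subseteq> ?h c i} \<le> card {T \<in> A. S \<subseteq> T}"
        using finA by (intro card_mono) auto
      then have "real (card {i \<in> ?I c. S \<subseteq> ?h c i}) * r ^ card S \<le> real (card {T \<in> A. S \<subseteq> T}) * r ^ card S"
        using r by (intro mult_right_mono) auto
      also have "\<dots> \<le> card A" using spr that by (auto simp: spread_def)
      finally show ?thesis .
    qed
    show "(\<Sum>S | S \<subseteq> ?h c i \<and> Suc (k (Suc j)) \<le> card S. (real q / r) ^ card S) \<le> B j"
      if "i \<in> ?I c" for c i
      using inv(3,4)[OF that] Suc.prems by (intro B) auto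
  qed (use B0 in auto)
  have "(\<Sum>c\<in>?C. card (A - fst (stage \<sigma> k X A c (Suc j)))) \<le> (\<Sum>c\<in>?C. card (A - ?I c) + card (?Bad c))"
    by (rule sum_mono) (rule le)
  also have "\<dots> = (\<Sum>c\<in>?C. card (A - ?I c)) + (\<Sum>c\<in>?C. card (?Bad c))"
    by (rule sum.distrib)
  finally have "real (\<Sum>c\<in>?C. card (A - fst (stage \<sigma> k X A c (Suc j))))
      \<le> real ((\<Sum>c\<in>?C. card (A - ?I c)) + (\<Sum>c\<in>?C. card (?Bad c)))"
    by (rule of_nat_mono)
  also have "\<dots> = real (\<Sum>c\<in>?C. card (A - ?I c)) + real (card (SIGMA c: ?C. ?Bad c))"
    by (simp only: of_nat_add card_SigmaI[OF finC ballI[OF finB]])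
  also have "\<dots> \<le> real q ^ card X * card A * (\<Sum>i<j. B i) + real q ^ card X * (card A * B j)"
    using Suc.prems by (intro add_mono Suc.IH bad) simp
  also have "\<dots> = real q ^ card X * card A * (\<Sum>i<Suc j. B i)"
    by (simp add: algebra_simps)
  finally show ?case .
qed auto

text \<open>Tilting with \<open>z = 5\<close> turns \<open>16 / r\<close> into
  \<open>80 / r\<close>. With \<open>m\<close> above the next cap,
  \<open>(1 + 80 / r) ^ k j <= exp m <= 3 ^ m\<close>, so a round loses a proportion of at most
  \<open>(3/5) ^ m\<close> with \<open>m >= 9\<close>. Seven such rounds cost less than 0.08 and the
  last one at most 0.3, together less than 1/2.\<close>

lemma card_uncovered_less:
  fixes \<sigma> :: "nat \<Rightarrow> nat"
  assumes X: "finite X" and A: "A \<subseteq> Pow X" "A \<noteq> {}" and k: "\<And>T. T \<in> A \<Longrightarrow> real (card T) \<le> 9 / 4 * r\<^sup>2"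
    and spr: "spread r A" and r: "r \<ge> 482"
    and \<sigma>: "inj_on \<sigma> {..<8}" "\<sigma> ` {..<8} \<subseteq> {..<16}"
  shows "2 * card {c \<in> X \<rightarrow>\<^sub>E {..<16}. \<not> (\<exists>T\<in>A. T \<subseteq> {x \<in> X. c x \<in> \<sigma> ` {..<8::nat}})} < 16 ^ card X"
proof -
  \<comment> \<open>\<open>k j\<close> is the size allowed to the fragments after \<open>j\<close> rounds: seven rounds shrink them to
    size 8, and the last one must remove them completely.\<close>
  define k :: "nat \<Rightarrow> nat" where
    "k = rec_nat (nat \<lfloor>9 / 4 * r\<^sup>2\<rfloor>) (\<lambda>j kj. if j < 7 then max 8 (nat \<lfloor>80 / r * kj\<rfloor>) else 0)"
  have k0: "k 0 = nat \<lfloor>9 / 4 * r\<^sup>2\<rfloor>" and kS: "k (Suc j) = (if j < 7 then max 8 (nat \<lfloor>80 / r * k j\<rfloor>) else 0)" for j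
    by (simp_all add: k_def)
  define B :: "nat \<Rightarrow> real" where "B j = (if j < 7 then (3 / 5) ^ 9 else 3 / 10)" for j
  have kle: "real (k j) \<le> max 8 (9 / 4 * r\<^sup>2 * (80 / r) ^ j)" if "j \<le> 7" for j
    using that
  proof (induction j)
    case 0
    show ?case unfolding k0 by (rule order_trans[OF of_nat_floor]) auto
  next
    case (Suc j)
    have "80 / r * k j \<le> 80 / r * max 8 (9 / 4 * r\<^sup>2 * (80 / r) ^ j)"
      using Suc r by (intro mult_left_mono) auto
    also have "\<dots> = max (80 / r * 8) (9 / 4 * r\<^sup>2 * (80 / r) ^ Suc j)"
      using r by (simp add: max_mult_distrib_left mult_ac)
    also have "\<dots> \<le> max 8 (9 / 4 * r\<^sup>2 * (80 / r) ^ Suc j)"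
      using r by (intro max.mono) (auto simp: field_simps)
    finally have "80 / r * k j \<le> max 8 (9 / 4 * r\<^sup>2 * (80 / r) ^ Suc j)" .
    moreover have "real (nat \<lfloor>80 / r * k j\<rfloor>) \<le> 80 / r * k j" using r by (simp add: of_nat_floor)
    ultimately show ?case using Suc.prems by (simp add: kS)
  qed
  \<comment> \<open>Seven reductions by \<open>r / 80\<close> leave a constant multiple of
    \<open>(80 / r) ^ 5\<close>, so the worst case is \<open>r = 482\<close>.\<close>
  have "9 / 4 * r\<^sup>2 * (80 / r) ^ 7 \<le> 8"
  proof -
    have "(r * (80 / r))\<^sup>2 = 80\<^sup>2" using r by simp
    then have "r\<^sup>2 * (80 / r)\<^sup>2 * (80 / r) ^ 5 = 80\<^sup>2 * (80 / r) ^ 5"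
      by (simp only: power_mult_distrib)
    then have "9 / 4 * r\<^sup>2 * (80 / r) ^ 7 = 9 / 4 * (80\<^sup>2 * (80 / r) ^ 5)"
      by (simp only: mult.assoc flip: power_add) simp
    also have "\<dots> \<le> 9 / 4 * (80\<^sup>2 * (80 / 482) ^ 5)"
      using r by (intro mult_left_mono power_mono divide_left_mono) auto
    also have "\<dots> \<le> 8" by (simp add: power_divide)
    finally show ?thesis .
  qed
  then have k7: "k 7 \<le> 8" using kle[of 7] by simp
  have Bj: "(\<Sum>S | S \<subseteq> H \<and> Suc (k (Suc j)) \<le> card S. (real 16 / r) ^ card S) \<le> B j"
    if j: "j < 8" and H: "H \<subseteq> X" "card H \<le> k j" for j H
  proof (cases "j < 7")
    case True
    let ?m = "Suc (k (Suc j))"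
    have m: "9 \<le> ?m" "80 / r * k j \<le> ?m"
      using True by (simp_all add: kS) linarith
    have "(\<Sum>S | S \<subseteq> H \<and> ?m \<le> card S. (real 16 / r) ^ card S) \<le> (1 + 16 / r * 5) ^ k j / 5 ^ ?m"
      using sum_large_subsets_le[of H "k j" "16 / r" 5 ?m] H X r finite_subset by fastforce
    also have "(1 + 16 / r * 5) ^ k j \<le> exp (80 / r) ^ k j"
      using exp_ge_add_one_self[of "80 / r"] r by (intro power_mono) auto
    also have "\<dots> = exp (80 / r * k j)" by (subst mult.commute) (simp only: exp_of_nat_mult)
    also have "\<dots> \<le> exp (real ?m)" using m by simp
    also have "\<dots> = exp 1 ^ ?m" using exp_of_nat_mult[of ?m "1::real"] by simp
    also have "\<dots> \<le> 3 ^ ?m" using exp_le by (intro power_mono) auto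
    also have "3 ^ ?m / 5 ^ ?m = (3 / 5 :: real) ^ ?m" by (simp add: power_divide)
    also have "\<dots> \<le> (3 / 5) ^ 9" using m by (intro power_decreasing) auto
    finally show ?thesis using True by (simp add: B_def divide_right_mono)
  next
    case False
    then have j7: "j = 7" using j by simp
    then have "card H \<le> 8" using H k7 by simp
    then have "(\<Sum>S | S \<subseteq> H \<and> 1 \<le> card S. (16 / r) ^ card S) \<le> (1 + 16 / r) ^ 8 - 1"
      using H X r finite_subset by (intro sum_nonempty_subsets_le) auto
    also have "\<dots> \<le> (1 + 16 / 482) ^ 8 - 1"
      using r by (intro diff_right_mono power_mono add_left_mono divide_left_mono) auto
    also have "\<dots> \<le> 3 / 10" by (simp add: field_simps)
    finally show ?thesis using False j7 kS[of 7] by (simp add: B_def)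
  qed
  let ?C = "X \<rightarrow>\<^sub>E {..<16::nat}"
  let ?I = "\<lambda>c. fst (stage \<sigma> k X A c 8)"
  let ?fail = "{c \<in> ?C. \<not> (\<exists>T\<in>A. T \<subseteq> {x \<in> X. c x \<in> \<sigma> ` {..<8::nat}})}"
  have finA: "finite A" using X A by (meson finite_Pow_iff finite_subset)
  have finC: "finite ?C" using X by (intro finite_PiE) auto
  have cardT: "card T \<le> k 0" if "T \<in> A" for T
    using k[OF that] unfolding k0 by linarith
  \<comment> \<open>The final cap is 0, so a surviving index would have an empty rest and a member
    would be covered. Thus a failing colouring loses all of \<open>A\<close>, and Markov's
    inequality applies.\<close>
  have "?I c = {}" if "c \<in> ?fail" for c
  proof (rule equals0I)
    fix i assume "i \<in> ?I c"
    from stage_invariant[OF A(1) cardT this]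
    have i: "snd (stage \<sigma> k X A c 8) i \<subseteq> {x \<in> X. c x \<notin> \<sigma> ` {..<8}}"
      "card (snd (stage \<sigma> k X A c 8) i) \<le> k 8"
      "\<exists>T\<in>A. T \<subseteq> {x \<in> X. c x \<in> \<sigma> ` {..<8}} \<union> snd (stage \<sigma> k X A c 8) i" by blast+
    have "finite (snd (stage \<sigma> k X A c 8) i)" by (rule finite_subset[OF i(1)]) (use X in simp)
    moreover have "k 8 = 0" using kS[of 7] by simp
    ultimately have "snd (stage \<sigma> k X A c 8) i = {}" using i(2) by simp
    then show False using i(3) that by auto
  qed
  then have "(\<Sum>c\<in>?fail. card A) \<le> (\<Sum>c\<in>?fail. card (A - ?I c))" by (intro sum_mono) auto
  also have "\<dots> \<le> (\<Sum>c\<in>?C. card (A - ?I c))" using finC by (intro sum_mono2) auto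
  finally have "card ?fail * card A \<le> (\<Sum>c\<in>?C. card (A - ?I c))" by simp
  then have "real (card ?fail * card A) \<le> real (\<Sum>c\<in>?C. card (A - ?I c))" by (rule of_nat_mono)
  also have "\<dots> \<le> real 16 ^ card X * card A * (\<Sum>i<8. B i)"
  proof (rule stage_loss[where J = 8, OF X A(1) cardT spr _ \<sigma> Bj])
    show "0 < r" using r by simp
    show "0 \<le> B j" for j by (simp add: B_def)
  qed auto
  also have "(\<Sum>i<8. B i) = 7 * (3 / 5) ^ 9 + 3 / 10"
    by (simp add: B_def eval_nat_numeral)
  finally have "real (card ?fail) * card A \<le> (16 ^ card X * (7 * (3 / 5) ^ 9 + 3 / 10)) * card A"
    by (simp add: mult_ac)
  moreover have "card A > 0" using finA A by (simp add: card_gt_0_iff)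
  ultimately have "real (card ?fail) \<le> 16 ^ card X * (7 * (3 / 5) ^ 9 + 3 / 10)"
    by (simp only: mult_le_cancel_right_pos of_nat_0_less_iff)
  also have "\<dots> < 16 ^ card X * (1 / 2)"
    by (intro mult_strict_left_mono) (simp_all add: eval_nat_numeral)
  finally have "real (2 * card ?fail) < real (16 ^ card X)" by simp
  then show ?thesis by (simp only: of_nat_less_iff)
qed

theorem spread_imp_disjoint_members:
  assumes X: "finite X" and r: "r \<ge> 482"
    and A: "A \<subseteq> Pow X" "A \<noteq> {}" "spread r A" "\<And>T. T \<in> A \<Longrightarrow> real (card T) \<le> 9 / 4 * r\<^sup>2"
    and B: "B \<subseteq> Pow X" "B \<noteq> {}" "spread r B" "\<And>T. T \<in> B \<Longrightarrow> real (card T) \<le> 9 / 4 * r\<^sup>2"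
  obtains T U where "T \<in> A" "U \<in> B" "T \<inter> U = {}"
proof -
  let ?C = "X \<rightarrow>\<^sub>E {..<16::nat}"
  let ?fail = "\<lambda>A \<sigma>. {c \<in> ?C. \<not> (\<exists>T\<in>A. T \<subseteq> {x \<in> X. c x \<in> \<sigma> ` {..<8::nat}})}"
  have finC: "finite ?C" using X by (intro finite_PiE) auto
  have "2 * card (?fail A (\<lambda>i. i)) < 16 ^ card X"
    by (rule card_uncovered_less[OF X A(1,2,4,3) r]) (auto simp: inj_on_def)
  moreover have "2 * card (?fail B (\<lambda>i. i + 8)) < 16 ^ card X"
    by (rule card_uncovered_less[OF X B(1,2,4,3) r]) (auto simp: inj_on_def)
  moreover have "card ?C = 16 ^ card X" using X by (simp add: card_PiE)
  moreover have "card (?fail A (\<lambda>i. i) \<union> ?fail B (\<lambda>i. i + 8)) \<le> card (?fail A (\<lambda>i. i)) + card (?fail B (\<lambda>i. i + 8))"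
    by (rule card_Un_le)
  ultimately have "card (?fail A (\<lambda>i. i) \<union> ?fail B (\<lambda>i. i + 8)) < card ?C" by linarith
  then have "?fail A (\<lambda>i. i) \<union> ?fail B (\<lambda>i. i + 8) \<noteq> ?C" by (metis less_irrefl)
  then obtain c where "c \<in> ?C" "c \<notin> ?fail A (\<lambda>i. i)" "c \<notin> ?fail B (\<lambda>i. i + 8)" by blast
  then obtain T U where TU: "T \<in> A" "T \<subseteq> {x \<in> X. c x \<in> (\<lambda>i. i) ` {..<8}}"
    "U \<in> B" "U \<subseteq> {x \<in> X. c x \<in> (\<lambda>i. i + 8) ` {..<8}}" by blast
  have "c x < 8" if "x \<in> T" for x using TU(2) that by auto
  moreover have "8 \<le> c x" if "x \<in> U" for x using TU(4) that by auto
  ultimately have "T \<inter> U = {}" by (meson disjoint_iff not_less)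
  then show thesis using that TU by blast
qed

section \<open>Spanning trees containing a given forest\<close>

abbreviation conn :: "nat set set \<Rightarrow> nat \<Rightarrow> nat \<Rightarrow> bool" where
  "conn S \<equiv> (adj S)\<^sup>*\<^sup>*"

lemma adj_sym: "adj S u v \<Longrightarrow> adj S v u"
  by (auto simp: adj_def insert_commute)

lemma conn_sym: "conn S u v \<Longrightarrow> conn S v u"
  by (induction rule: rtranclp_induct) (auto intro: adj_sym converse_rtranclp_into_rtranclp)

lemma conn_cong: "conn S u v \<Longrightarrow> conn S u w \<longleftrightarrow> conn S v w"
  using conn_sym rtranclp_trans[of "adj S"] by blast

lemma conn_mono: "S \<subseteq> S' \<Longrightarrow> conn S u v \<Longrightarrow> conn S' u v"
  by (rule rtranclp_mono[THEN predicate2D]) (auto simp: adj_def)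

lemma conn_edge: "{u, v} \<in> S \<Longrightarrow> conn S u v"
  by (cases "u = v") (auto simp: adj_def)

lemma conn_insert_iff:
  "conn (insert {u, v} S) x y \<longleftrightarrow>
    conn S x y \<or> (conn S x u \<and> conn S v y) \<or> (conn S x v \<and> conn S u y)" (is "?L \<longleftrightarrow> ?R")
proof
  assume ?L
  then show ?R
  proof (induction rule: rtranclp_induct)
    case (step y z)
    show ?case
    proof (cases "{y, z} \<in> S")
      case True
      then have "conn S y z" by (rule conn_edge)
      then show ?thesis using step.IH by (meson rtranclp_trans)
    next
      case False
      then have "y = u \<and> z = v \<or> y = v \<and> z = u" using step.hyps(2) by (auto simp: adj_def doubleton_eq_iff)
      then show ?thesis using step.IH by auto
    qed
  qed simp
next
  have uv: "conn (insert {u, v} S) u v" by (rule conn_edge) simp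
  have S: "conn S a b \<Longrightarrow> conn (insert {u, v} S) a b" for a b by (rule conn_mono[rotated]) auto
  assume ?R
  then show ?L using S uv conn_sym[OF uv] by (meson rtranclp_trans)
qed

definition component :: "nat \<Rightarrow> nat set set \<Rightarrow> nat \<Rightarrow> nat set" where
  "component n S v = {w \<in> {1..n}. conn S v w}"

definition comps :: "nat \<Rightarrow> nat set set \<Rightarrow> nat set set" where
  "comps n S = component n S ` {1..n}"

lemma finite_component [simp]: "finite (component n S v)" and component_subset: "component n S v \<subseteq> {1..n}"
  by (auto simp: component_def)

lemma finite_comps [simp]: "finite (comps n S)"
  by (simp add: comps_def)

lemma component_self: "v \<in> {1..n} \<Longrightarrow> v \<in> component n S v"
  by (simp add: component_def)

lemma component_eq_iff: "v \<in> {1..n} \<Longrightarrow> w \<in> {1..n} \<Longrightarrow> component n S v = component n S w \<longleftrightarrow> conn S v w"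
  using conn_cong[of S v w] conn_sym[of S w v] by (auto simp: component_def set_eq_iff)

lemma component_eqI: "conn S v w \<Longrightarrow> component n S v = component n S w"
  using conn_cong[of S v w] by (simp add: component_def)

lemma component_in_comps: "v \<in> {1..n} \<Longrightarrow> component n S v \<in> comps n S"
  by (simp add: comps_def)

lemma comps_eqI:
  assumes "C \<in> comps n S" "v \<in> C"
  shows "C = component n S v"
proof -
  obtain w where "C = component n S w" using assms(1) by (auto simp: comps_def)
  then show ?thesis using component_eqI[of S w v n] assms(2) by (simp add: component_def)
qed

lemma comps_disjoint: "C \<in> comps n S \<Longrightarrow> D \<in> comps n S \<Longrightarrow> C \<noteq> D \<Longrightarrow> C \<inter> D = {}"
  using comps_eqI by blast

lemma Union_comps: "\<Union>(comps n S) = {1..n}"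
  using component_self component_subset by (fastforce simp: comps_def)

lemma comps_nonempty: "C \<in> comps n S \<Longrightarrow> C \<noteq> {}"
  using component_self by (fastforce simp: comps_def)

lemma finite_in_comps: "C \<in> comps n S \<Longrightarrow> finite C"
  by (auto simp: comps_def)

lemma sum_comps:
  fixes f :: "nat \<Rightarrow> 'b :: comm_monoid_add"
  shows "(\<Sum>C\<in>comps n S. \<Sum>v\<in>C. f v) = (\<Sum>v=1..n. f v)"
  using sum.Union_disjoint[of "comps n S" f] comps_disjoint finite_in_comps
  by (simp add: Union_comps)

lemma comps_insert_conn:
  assumes "conn S u v"
  shows "comps n (insert {u, v} S) = comps n S"
proof -
  have "conn (insert {u, v} S) x y \<longleftrightarrow> conn S x y" for x y
    unfolding conn_insert_iff using assms conn_sym[OF assms] by (meson rtranclp_trans)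
  then show ?thesis by (simp add: comps_def component_def)
qed

lemma comps_insert:
  assumes "u \<in> {1..n}" "v \<in> {1..n}"
  shows "comps n (insert {u, v} S) = insert (component n S u \<union> component n S v) (comps n S - {component n S u, component n S v})"
    (is "?L = ?R")
proof -
  let ?U = "component n S u \<union> component n S v"
  have 1: "component n (insert {u, v} S) w = (if w \<in> ?U then ?U else component n S w)" if "w \<in> {1..n}" for w
  proof -
    have U: "x \<in> ?U \<longleftrightarrow> conn S u x \<or> conn S v x" if "x \<in> {1..n}" for x
      using that by (auto simp: component_def)
    have "conn (insert {u, v} S) w x \<longleftrightarrow> (if w \<in> ?U then x \<in> ?U else conn S w x)" if "x \<in> {1..n}" for x
      unfolding conn_insert_iff U[OF that] U[OF \<open>w \<in> {1..n}\<close>]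
      using conn_cong[of S w u x] conn_cong[of S w v x] conn_sym[of S w u] conn_sym[of S w v]
        conn_sym[of S u w] conn_sym[of S v w] by (cases "conn S w u"; cases "conn S w v") auto
    then have "component n (insert {u, v} S) w = {x \<in> {1..n}. if w \<in> ?U then x \<in> ?U else conn S w x}"
      unfolding component_def by blast
    then show ?thesis by (auto simp: component_def)
  qed
  have 2: "w \<in> ?U \<longleftrightarrow> component n S w \<in> {component n S u, component n S v}" if "w \<in> {1..n}" for w
    using that assms conn_sym[of S] by (auto simp: component_eq_iff) (auto simp: component_def)
  show ?thesis
  proof (intro equalityI subsetI)
    fix C assume "C \<in> ?L"
    then obtain w where "w \<in> {1..n}" "C = component n (insert {u, v} S) w" by (auto simp: comps_def)
    then show "C \<in> ?R" using 1 2 by (auto simp: comps_def)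
  next
    fix C assume C: "C \<in> ?R"
    show "C \<in> ?L"
    proof (cases "C = ?U")
      case True
      then have "C = component n (insert {u, v} S) u" using 1[OF assms(1)] component_self[OF assms(1)] by simp
      then show ?thesis using assms by (simp add: comps_def)
    next
      case False
      then have "C \<in> comps n S" and w3: "C \<notin> {component n S u, component n S v}" using C by blast+
      then obtain w where w: "w \<in> {1..n}" "C = component n S w" unfolding comps_def by blast
      then have "C = component n (insert {u, v} S) w" using 1[OF w(1)] 2[OF w(1)] w3 by simp
      then show ?thesis using w by (simp add: comps_def)
    qed
  qed
qed

text \<open>Makes the \<open>insert\<close> in \<open>comps_insert\<close> a genuine one, as needed
  for cardinalities and products: a component containing \<open>u\<close> is the component of
  \<open>u\<close>, which has been removed.\<close>

lemma comps_merge_notin: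
  assumes "u \<in> {1..n}" "v \<in> {1..n}"
  shows "component n S u \<union> component n S v \<notin> comps n S - {component n S u, component n S v}"
  using comps_eqI[of _ n S u] component_self[OF assms(1)] by blast

lemma card_comps_insert:
  assumes "u \<in> {1..n}" "v \<in> {1..n}" "\<not> conn S u v"
  shows "card (comps n S) = Suc (card (comps n (insert {u, v} S)))"
proof -
  have ne: "component n S u \<noteq> component n S v" using assms by (simp add: component_eq_iff)
  have "{component n S u, component n S v} \<subseteq> comps n S" using assms component_in_comps by auto
  then have "card (comps n S) = card (comps n S - {component n S u, component n S v}) + 2"
    using ne card_Diff_subset[of "{component n S u, component n S v}" "comps n S"]
      card_mono[of "comps n S" "{component n S u, component n S v}"] by simp
  then show ?thesis
    using comps_merge_notin[OF assms(1,2)] by (simp add: comps_insert[OF assms(1,2)])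
qed

lemma comps_empty: "comps n {} = (\<lambda>v. {v}) ` {1..n}"
proof -
  have "adj {} = (\<lambda>_ _. False)" by (auto simp: adj_def fun_eq_iff)
  then have "conn {} u v \<longleftrightarrow> u = v" for u v by (auto elim: converse_rtranclpE)
  then have "component n {} v = {v}" if "v \<in> {1..n}" for v using that by (auto simp: component_def)
  then show ?thesis by (auto simp: comps_def)
qed

section \<open>Forests, characterized by counting components\<close>

lemma finite_Kn_edges [simp]: "finite (Kn_edges n)"
proof -
  have "Kn_edges n \<subseteq> Pow {1..n}" by (auto simp: Kn_edges_def)
  then show ?thesis by (rule finite_subset) simp
qed

lemma Kn_edgesE:
  assumes "e \<in> Kn_edges n"
  obtains u v where "e = {u, v}" "u \<in> {1..n}" "v \<in> {1..n}" "u \<noteq> v"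
  using assms by (auto simp: Kn_edges_def)

lemma Kn_edges_pair [simp]: "{u, v} \<in> Kn_edges n \<longleftrightarrow> u \<in> {1..n} \<and> v \<in> {1..n} \<and> u \<noteq> v"
  by (auto simp: Kn_edges_def doubleton_eq_iff)

lemma card_comps_insert_le:
  assumes "e \<in> Kn_edges n"
  shows "card (comps n S) \<le> Suc (card (comps n (insert e S)))"
proof -
  obtain u v where e: "e = {u, v}" "u \<in> {1..n}" "v \<in> {1..n}" using assms by (elim Kn_edgesE)
  show ?thesis
    by (cases "conn S u v") (simp_all add: e comps_insert_conn card_comps_insert[OF e(2,3)])
qed

text \<open>A new edge adds one to the number of edges and removes at most one component.\<close>

lemma card_comps_add_card_mono:
  assumes "S \<subseteq> T" "T \<subseteq> Kn_edges n"
  shows "card (comps n S) + card S \<le> card (comps n T) + card T"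
proof -
  have "finite D \<Longrightarrow> D \<subseteq> Kn_edges n \<Longrightarrow> D \<inter> S = {} \<Longrightarrow>
      card (comps n S) + card S \<le> card (comps n (D \<union> S)) + card (D \<union> S)" for D
  proof (induction D rule: finite_induct)
    case (insert e D)
    have "finite S" using assms finite_subset[OF _ finite_Kn_edges] by blast
    moreover have "e \<notin> D \<union> S" using insert by auto
    ultimately have "card (insert e (D \<union> S)) = Suc (card (D \<union> S))" using insert.hyps by simp
    then show ?case using insert card_comps_insert_le[of e n "D \<union> S"] by auto
  qed simp
  from this[of "T - S"] have "card (comps n S) + card S \<le> card (comps n (T - S \<union> S)) + card (T - S \<union> S)"
    using assms finite_subset[OF _ finite_Kn_edges] by blast
  then show ?thesis using assms by (simp add: Un_absorb2)
qed

text \<open>Acyclicity as a count: \<open>n\<close> is the value of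
  \<open>card (comps n S) + card S\<close> at \<open>{}\<close>, which by monotonicity is the least
  possible one.\<close>

definition forest :: "nat \<Rightarrow> nat set set \<Rightarrow> bool" where
  "forest n S \<longleftrightarrow> S \<subseteq> Kn_edges n \<and> card (comps n S) + card S = n"

lemma card_comps_empty: "card (comps n {}) = n"
  by (simp add: comps_empty card_image)

lemma forest_empty: "forest n {}"
  by (simp add: forest_def card_comps_empty)

lemma forest_finite: "forest n S \<Longrightarrow> finite S"
  using finite_subset[OF _ finite_Kn_edges] by (auto simp: forest_def)

text \<open>The count of \<open>S\<close> is squeezed between those of \<open>{}\<close> and
  \<open>T\<close>, both equal to \<open>n\<close>.\<close>

lemma forest_subset:
  assumes "forest n T" "S \<subseteq> T"
  shows "forest n S"
proof -
  have "S \<subseteq> Kn_edges n" using assms by (auto simp: forest_def)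
  then show ?thesis
    using card_comps_add_card_mono[OF assms(2), of n] card_comps_add_card_mono[of "{}" S n] assms(1)
    by (simp add: forest_def card_comps_empty)
qed

lemma forest_insert_iff:
  assumes S: "forest n S" and uv: "u \<in> {1..n}" "v \<in> {1..n}" and notin: "{u, v} \<notin> S"
  shows "forest n (insert {u, v} S) \<longleftrightarrow> \<not> conn S u v"
proof (cases "conn S u v")
  case True
  then show ?thesis
    using S notin forest_finite[OF S] by (auto simp: forest_def comps_insert_conn)
next
  case False
  then have "u \<noteq> v" by auto
  then show ?thesis
    using False S notin uv forest_finite[OF S] card_comps_insert[OF uv False] by (auto simp: forest_def)
qed

section \<open>Spanning trees: from cycles to counts\<close>

lemma connected_on_iff:
  assumes "n \<ge> 1"
  shows "connected_on n T \<longleftrightarrow> card (comps n T) = 1"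
proof
  assume "connected_on n T"
  then have "component n T v = {1..n}" if "v \<in> {1..n}" for v
    using that by (auto simp: connected_on_def component_def)
  then have "comps n T = {{1..n}}" using assms by (auto simp: comps_def)
  then show "card (comps n T) = 1" by simp
next
  assume "card (comps n T) = 1"
  then obtain C where "comps n T = {C}" by (auto simp: card_1_singleton_iff)
  then have "component n T u = component n T v" if "u \<in> {1..n}" "v \<in> {1..n}" for u v
    using component_in_comps[OF that(1), of T] component_in_comps[OF that(2), of T] by simp
  then show "connected_on n T" by (simp add: connected_on_def component_eq_iff)
qed

text \<open>The other edges of the cycle join the ends of its closing edge.\<close>

lemma cycle_imp_conn:
  assumes "is_cycle T cs"
  obtains u v where "{u, v} \<in> T" "conn (T - {{u, v}}) u v"
proof -
  let ?m = "length cs - 1"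
  let ?f = "{cs ! 0, cs ! ?m}"
  have len: "length cs \<ge> 3" and dist: "distinct cs" and "adj T (last cs) (hd cs)"
    and step: "\<And>i. Suc i < length cs \<Longrightarrow> adj T (cs ! i) (cs ! Suc i)"
    using assms by (auto simp: is_cycle_def)
  moreover have "cs \<noteq> []" using len by auto
  then have "last cs = cs ! ?m" "hd cs = cs ! 0" by (simp_all add: last_conv_nth hd_conv_nth)
  ultimately have f: "?f \<in> T" unfolding adj_def by (metis insert_commute)
  have "conn (T - {?f}) (cs ! 0) (cs ! i)" if "i < length cs" for i
    using that
  proof (induction i)
    case (Suc i)
    \<comment> \<open>Distinct vertices and length at least 3 ensure that no step of the list
      repeats the closing edge.\<close>
    have "{cs ! i, cs ! Suc i} \<noteq> ?f"
    proof -
      have "cs ! i = cs ! 0 \<longleftrightarrow> i = 0" "cs ! Suc i = cs ! ?m \<longleftrightarrow> Suc i = ?m" "cs ! i = cs ! ?m \<longleftrightarrow> i = ?m"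
        using Suc.prems len by (auto intro!: nth_eq_iff_index_eq[OF dist])
      then show ?thesis using Suc.prems len unfolding doubleton_eq_iff by linarith
    qed
    then have "adj (T - {?f}) (cs ! i) (cs ! Suc i)"
      using step[OF Suc.prems] by (auto simp: adj_def)
    then show ?case using Suc by (auto intro: rtranclp.rtrancl_into_rtrancl)
  qed simp
  then have "conn (T - {?f}) (cs ! 0) (cs ! ?m)" using len by simp
  then show thesis by (rule that[OF f])
qed

text \<open>A path avoiding the edge, reduced to distinct vertices, has at least two steps because
  the single step is the removed edge. Closing it up yields the three vertices that
  \<open>is_cycle\<close> demands.\<close>

lemma conn_imp_cycle:
  assumes "{u, v} \<in> T" "u \<noteq> v" "conn (T - {{u, v}}) u v"
  shows "\<exists>cs. is_cycle T cs"
proof -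
  let ?r = "adj (T - {{u, v}})"
  obtain xs0 where "rtrancl_path ?r u xs0 v" using assms(3) rtranclp_eq_rtrancl_path by metis
  then obtain xs where p: "rtrancl_path ?r u xs v" and d: "distinct (u # xs)"
    by (rule rtrancl_path_distinct)
  have ne: "xs \<noteq> []" using p assms(2) by (auto elim: rtrancl_path.cases)
  have last: "last xs = v" by (rule rtrancl_path_last[OF p ne])
  have step: "?r ((u # xs) ! i) (xs ! i)" if "i < length xs" for i
    by (rule rtrancl_path_nth[OF p that])
  have "length xs \<noteq> 1"
  proof
    assume l: "length xs = 1"
    then have "xs ! 0 = v" using last ne by (simp add: last_conv_nth)
    then show False using step[of 0] l by (simp add: adj_def)
  qed
  then have "length xs \<ge> 2" using ne by (cases xs) (auto simp: Suc_le_eq)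
  moreover have "adj T ((u # xs) ! i) ((u # xs) ! Suc i)" if "Suc i < length (u # xs)" for i
    using step[of i] that by (simp add: adj_def)
  moreover have "adj T (last (u # xs)) (hd (u # xs))"
    using last ne assms(1,2) by (simp add: adj_def insert_commute)
  ultimately have "is_cycle T (u # xs)"
    unfolding is_cycle_def using d by (metis One_nat_def Suc_1 Suc_le_mono length_Cons numeral_3_eq_3)
  then show ?thesis ..
qed

text \<open>Forwards, the edges are added one at a time, and an edge inside a component would close
  a cycle. Backwards, an edge on a cycle could be deleted without changing the components, which
  would push the count below its minimum \<open>n\<close>.\<close>

lemma spanning_tree_iff:
  assumes "n \<ge> 1"
  shows "spanning_tree n T \<longleftrightarrow> T \<subseteq> Kn_edges n \<and> card (comps n T) = 1 \<and> card T = n - 1"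
proof (intro iffI conjI)
  assume T: "spanning_tree n T"
  then show sub: "T \<subseteq> Kn_edges n" and one: "card (comps n T) = 1"
    using connected_on_iff[OF assms] by (auto simp: spanning_tree_def)
  have ac: "\<nexists>cs. is_cycle T cs" using T by (simp add: spanning_tree_def acyclic_graph_def)
  have finT: "finite T" using sub finite_subset[OF _ finite_Kn_edges] by blast
  have "forest n S" if "finite S" "S \<subseteq> T" for S
    using that
  proof (induction S rule: finite_induct)
    case (insert e S)
    obtain u v where e: "e = {u, v}" "u \<in> {1..n}" "v \<in> {1..n}" "u \<noteq> v"
      using insert.prems sub by (meson Kn_edgesE insert_subset subsetD)
    have "\<not> conn (T - {{u, v}}) u v" using conn_imp_cycle[of u v T] ac e insert.prems by auto
    then have "\<not> conn S u v" using conn_mono[of S "T - {{u, v}}"] insert e by auto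
    then show ?case using forest_insert_iff[of n S u v] insert e by auto
  qed (rule forest_empty)
  from this[OF finT order_refl] show "card T = n - 1" using one by (auto simp: forest_def)
next
  assume T: "T \<subseteq> Kn_edges n \<and> card (comps n T) = 1 \<and> card T = n - 1"
  have finT: "finite T" using T finite_subset[OF _ finite_Kn_edges] by blast
  have "\<not> is_cycle T cs" for cs
  proof
    assume "is_cycle T cs"
    then obtain u v where uv: "{u, v} \<in> T" "conn (T - {{u, v}}) u v" by (rule cycle_imp_conn)
    have "card (comps n (T - {{u, v}})) = card (comps n T)"
      using comps_insert_conn[OF uv(2), of n] uv(1) by (simp add: insert_absorb)
    moreover have "card T > 0" using uv finT by (auto simp: card_gt_0_iff)
    moreover have "card (comps n {}) + card ({} :: nat set set) \<le> card (comps n (T - {{u, v}})) + card (T - {{u, v}})"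
      using T by (intro card_comps_add_card_mono) auto
    ultimately show False using T uv(1) finT by (simp add: card_comps_empty)
  qed
  then show "spanning_tree n T"
    using T connected_on_iff[OF assms] by (simp add: spanning_tree_def acyclic_graph_def)
qed

lemma spanning_tree_forest: "n \<ge> 1 \<Longrightarrow> spanning_tree n T \<Longrightarrow> forest n T"
  by (simp add: spanning_tree_iff forest_def)

lemma spanning_treeI_forest: "n \<ge> 1 \<Longrightarrow> forest n T \<Longrightarrow> card T = n - 1 \<Longrightarrow> spanning_tree n T"
  by (auto simp: spanning_tree_iff forest_def)

section \<open>Counting the spanning trees above a forest\<close>

lemma card_ordered_edges:
  assumes "D \<subseteq> Kn_edges n"
  shows "card {(u, v). {u, v} \<in> D} = 2 * card D"
proof -
  have "finite D" using assms finite_subset[OF _ finite_Kn_edges] by blast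
  then have "finite {(u, v). {u, v} \<in> D} \<and> card {(u, v). {u, v} \<in> D} = 2 * card D"
    using assms
  proof (induction D rule: finite_induct)
    case (insert e D)
    obtain a b where e: "e = {a, b}" "a \<noteq> b" using insert.prems by (meson Kn_edgesE insert_subset)
    have eq: "{(u, v). {u, v} \<in> insert e D} = insert (a, b) (insert (b, a) {(u, v). {u, v} \<in> D})"
      by (auto simp: e doubleton_eq_iff)
    have "(a, b) \<notin> {(u, v). {u, v} \<in> D}" "(b, a) \<notin> {(u, v). {u, v} \<in> D}"
      using insert.hyps by (auto simp: e insert_commute)
    then show ?case using insert e unfolding eq by simp
  qed simp
  then show ?thesis ..
qed

definition trees_containing :: "nat \<Rightarrow> nat set set \<Rightarrow> nat set set set" where
  "trees_containing n S = {T \<in> spanning_trees n. S \<subseteq> T}"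

lemma finite_spanning_trees [simp]: "finite (spanning_trees n)"
proof -
  have "spanning_trees n \<subseteq> Pow (Kn_edges n)" by (auto simp: spanning_trees_def spanning_tree_def)
  then show ?thesis by (rule finite_subset) simp
qed

lemma finite_trees_containing [simp]: "finite (trees_containing n S)"
  by (simp add: trees_containing_def)

lemma sum_inverse_card_comp: "(\<Sum>v=1..n. 1 / real (card (component n S v))) = card (comps n S)"
proof -
  have "(\<Sum>v=1..n. 1 / real (card (component n S v))) = (\<Sum>C\<in>comps n S. \<Sum>v\<in>C. 1 / real (card (component n S v)))"
    by (rule sum_comps[symmetric])
  also have "\<dots> = (\<Sum>C\<in>comps n S. 1)"
  proof (rule sum.cong)
    fix C assume C: "C \<in> comps n S"
    have "(\<Sum>v\<in>C. 1 / real (card (component n S v))) = (\<Sum>v\<in>C. 1 / real (card C))"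
      using comps_eqI[OF C] by (intro sum.cong) auto
    also have "\<dots> = 1" using comps_nonempty[OF C] finite_in_comps[OF C] by simp
    finally show "(\<Sum>v\<in>C. 1 / real (card (component n S v))) = 1" .
  qed simp
  finally show ?thesis by simp
qed

text \<open>This is \<open>a + b = a * b * (1 / a + 1 / b)\<close> for the two merged sizes.
  Reciprocals are what can later be summed over all pairs of vertices.\<close>

lemma prod_comps_insert:
  assumes uv: "u \<in> {1..n}" "v \<in> {1..n}" "\<not> conn S u v"
  shows "(\<Prod>C\<in>comps n (insert {u, v} S). real (card C))
    = (\<Prod>C\<in>comps n S. real (card C)) * (1 / card (component n S u) + 1 / card (component n S v))"
proof -
  let ?u = "component n S u" and ?v = "component n S v"
  have ne: "?u \<noteq> ?v" using uv by (simp add: component_eq_iff)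
  have mem: "?u \<in> comps n S" "?v \<in> comps n S" using uv component_in_comps by auto
  then have disj: "?u \<inter> ?v = {}" using ne comps_disjoint by blast
  have nonempty: "?u \<noteq> {}" "?v \<noteq> {}" using comps_nonempty mem by auto
  then have pos: "card ?u > 0" "card ?v > 0" by (auto simp: card_gt_0_iff)
  have "(\<Prod>C\<in>comps n S. real (card C)) = real (card ?u) * (real (card ?v) * (\<Prod>C\<in>comps n S - {?u, ?v}. real (card C)))"
    using mem ne by (simp add: prod.remove[of _ ?u] prod.remove[of _ ?v] Diff_insert2[symmetric] insert_commute)
  moreover have "(\<Prod>C\<in>comps n (insert {u, v} S). real (card C))
      = (real (card ?u) + real (card ?v)) * (\<Prod>C\<in>comps n S - {?u, ?v}. real (card C))"
    using comps_merge_notin[OF uv(1,2)] disj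
    by (simp add: comps_insert[OF uv(1,2)] card_Un_disjoint)
  ultimately show ?thesis using pos nonempty by (simp add: field_simps)
qed

text \<open>Downward induction on the number of components, counting pairs of a tree \<open>T\<close> above \<open>S\<close>
  and an ordered pair of adjacent vertices whose edge lies in \<open>T - S\<close>.\<close>
theorem card_trees_containing:
  assumes n: "n \<ge> 1" and S: "forest n S"
  shows "real n ^ 2 * card (trees_containing n S)
    = real n ^ card (comps n S) * (\<Prod>C\<in>comps n S. real (card C))"
  using S
proof (induction "card (comps n S)" arbitrary: S rule: less_induct)
  case less
  note S = \<open>forest n S\<close>
  let ?c = "card (comps n S)" and ?P = "\<Prod>C\<in>comps n S. real (card C)"
  have "comps n S \<noteq> {}" using n by (auto simp: comps_def)
  then have c1: "?c \<ge> 1" by (simp add: Suc_le_eq card_gt_0_iff)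
  show ?case
  \<comment> \<open>The formula is \<open>n ^ (c - 2)\<close> times the product of the component
    sizes, which for \<open>S = {}\<close> is Cayley's formula. The factor \<open>n ^ 2\<close> on
    the left avoids the negative exponent of the present case.\<close>
  proof (cases "?c = 1")
    case True
    then have tree: "spanning_tree n S" using S n by (intro spanning_treeI_forest) (auto simp: forest_def)
    have "T = S" if T: "spanning_tree n T" "S \<subseteq> T" for T
    proof (rule card_subset_eq[symmetric, OF _ T(2)])
      show "finite T" using T(1) forest_finite spanning_tree_forest[OF n] by blast
      show "card S = card T" using tree T(1) by (simp add: spanning_tree_iff[OF n])
    qed
    then have "trees_containing n S = {S}" using tree by (auto simp: trees_containing_def spanning_trees_def)
    moreover obtain C where C: "comps n S = {C}" using True by (auto simp: card_1_singleton_iff)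
    moreover have "C = {1..n}" using Union_comps[of n S] C by simp
    ultimately show ?thesis by (simp add: power2_eq_square)
  next
    case False
    then have c2: "?c \<ge> 2" using c1 by simp
    define Q where "Q = {p \<in> {1..n} \<times> {1..n}. \<not> conn S (fst p) (snd p)}"
    have finQ: "finite Q" by (simp add: Q_def)
    let ?N = "trees_containing n S"
    \<comment> \<open>\<open>T - S\<close> has \<open>c - 1\<close> edges, each counted in both
      orders. All of them run between different components of \<open>S\<close>, since
      \<open>T\<close> is a forest.\<close>
    have inner: "card {p \<in> Q. {fst p, snd p} \<in> T} = 2 * (?c - 1)" if T: "T \<in> ?N" for T
    proof -
      have tree: "spanning_tree n T" "S \<subseteq> T" using T by (auto simp: trees_containing_def spanning_trees_def)
      have fo: "forest n T" by (rule spanning_tree_forest[OF n tree(1)])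
      have sub: "T - S \<subseteq> Kn_edges n" using fo by (auto simp: forest_def)
      have "p \<in> Q \<and> {fst p, snd p} \<in> T \<longleftrightarrow> {fst p, snd p} \<in> T - S" for p
      proof (intro iffI conjI)
        assume "{fst p, snd p} \<in> T - S"
        moreover from this have "fst p \<in> {1..n}" "snd p \<in> {1..n}" using sub by (auto simp del: atLeastAtMost_iff)
        moreover have "forest n (insert {fst p, snd p} S)"
          by (rule forest_subset[OF fo]) (use \<open>{fst p, snd p} \<in> T - S\<close> tree in auto)
        ultimately show "p \<in> Q"
          using forest_insert_iff[OF S] by (auto simp: Q_def mem_Times_iff simp del: atLeastAtMost_iff)
      qed (auto simp: Q_def intro: conn_edge)
      then have "{p \<in> Q. {fst p, snd p} \<in> T} = {(u, v). {u, v} \<in> T - S}" by auto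
      then have "card {p \<in> Q. {fst p, snd p} \<in> T} = 2 * card (T - S)"
        using card_ordered_edges[OF sub] by simp
      also have "card (T - S) = card T - card S"
        using tree forest_finite[OF S] by (simp add: card_Diff_subset)
      also have "\<dots> = ?c - 1" using tree(1) S by (auto simp: spanning_tree_iff[OF n] forest_def)
      finally show ?thesis .
    qed
    \<comment> \<open>Induction hypothesis for \<open>S\<close> with one more edge, which has one
      component less.\<close>
    have outer: "real n ^ 2 * card {T \<in> ?N. {fst p, snd p} \<in> T}
        = real n ^ (?c - 1) * ?P * (1 / card (component n S (fst p)) + 1 / card (component n S (snd p)))"
      if p: "p \<in> Q" for p
    proof -
      obtain u v where uv: "p = (u, v)" "u \<in> {1..n}" "v \<in> {1..n}" "\<not> conn S u v"
        using p by (cases p) (simp add: Q_def)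
      let ?S = "insert {u, v} S"
      have "{T \<in> ?N. {fst p, snd p} \<in> T} = trees_containing n ?S"
        by (auto simp: trees_containing_def uv(1))
      moreover have "{u, v} \<notin> S" using uv conn_edge by auto
      then have "forest n ?S" using forest_insert_iff[OF S uv(2,3)] uv(4) by blast
      moreover have "?c = Suc (card (comps n ?S))" by (rule card_comps_insert[OF uv(2-4)])
      ultimately show ?thesis using less.hyps[of ?S] prod_comps_insert[OF uv(2-4)] by (simp add: uv(1))
    qed
    \<comment> \<open>For fixed \<open>u\<close>, every component other than that of
      \<open>u\<close> contributes exactly 1.\<close>
    have half: "(\<Sum>p\<in>Q. 1 / real (card (component n S (snd p)))) = n * (real ?c - 1)"
    proof -
      have "(\<Sum>p\<in>Q. 1 / real (card (component n S (snd p))))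
          = (\<Sum>u=1..n. \<Sum>v\<in>{1..n} - component n S u. 1 / real (card (component n S v)))"
      proof -
        have "Q = (SIGMA u:{1..n}. {1..n} - component n S u)" by (auto simp: Q_def component_def)
        then show ?thesis by (simp add: sum.Sigma case_prod_unfold)
      qed
      also have "\<dots> = (\<Sum>u=1..n. real ?c - 1)"
      proof (rule sum.cong)
        fix u assume u: "u \<in> {1..n}"
        have C: "component n S u \<in> comps n S" by (rule component_in_comps[OF u])
        have "(\<Sum>v\<in>component n S u. 1 / real (card (component n S v))) = (\<Sum>v\<in>component n S u. 1 / real (card (component n S u)))"
          using comps_eqI[OF C] by (intro sum.cong) auto
        also have "\<dots> = 1" using comps_nonempty[OF C] by simp
        finally have "(\<Sum>v\<in>component n S u. 1 / real (card (component n S v))) = 1" .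
        moreover have "(\<Sum>v\<in>{1..n} - component n S u. 1 / real (card (component n S v)))
            = (\<Sum>v=1..n. 1 / real (card (component n S v))) - (\<Sum>v\<in>component n S u. 1 / real (card (component n S v)))"
          by (rule sum_diff[OF _ component_subset]) simp
        ultimately show "(\<Sum>v\<in>{1..n} - component n S u. 1 / real (card (component n S v))) = real ?c - 1"
          by (simp only: sum_inverse_card_comp)
      qed simp
      finally show ?thesis by simp
    qed
    have swap: "(\<Sum>p\<in>Q. 1 / real (card (component n S (fst p)))) = (\<Sum>p\<in>Q. 1 / real (card (component n S (snd p))))"
      by (rule sum.reindex_bij_witness[of _ prod.swap prod.swap]) (auto simp: Q_def dest: conn_sym)
    have "real n ^ 2 * (card ?N * (2 * (?c - 1))) = real n ^ 2 * (\<Sum>T\<in>?N. card {p \<in> Q. {fst p, snd p} \<in> T})"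
      using inner by simp
    also have "(\<Sum>T\<in>?N. card {p \<in> Q. {fst p, snd p} \<in> T}) = (\<Sum>p\<in>Q. card {T \<in> ?N. {fst p, snd p} \<in> T})"
      using finQ sum.swap_restrict[of ?N Q "\<lambda>_ _. 1::nat" "\<lambda>T p. {fst p, snd p} \<in> T"] by simp
    also have "real n ^ 2 * real \<dots> = (\<Sum>p\<in>Q. real n ^ 2 * card {T \<in> ?N. {fst p, snd p} \<in> T})"
      by (simp add: sum_distrib_left)
    also have "\<dots> = (\<Sum>p\<in>Q. real n ^ (?c - 1) * ?P * (1 / card (component n S (fst p)) + 1 / card (component n S (snd p))))"
      using outer by (intro sum.cong) auto
    also have "\<dots> = real n ^ (?c - 1) * ?P * (2 * (n * (real ?c - 1)))"
      by (simp only: sum_distrib_left[symmetric] sum.distrib swap half mult_2)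
    also have "\<dots> = real n ^ ?c * ?P * (2 * (real ?c - 1))"
    proof -
      have "real n ^ ?c = real n ^ (?c - 1) * real n"
        by (rule power_minus_mult[symmetric]) (use c1 in linarith)
      then show ?thesis by (simp only: mult_ac)
    qed
    finally have eq: "real n ^ 2 * real (card ?N * (2 * (?c - 1))) = real n ^ ?c * ?P * (2 * (real ?c - 1))" .
    have "real (card ?N * (2 * (?c - 1))) = real (card ?N) * (2 * (real ?c - 1))"
      using c1 by (simp add: of_nat_diff)
    then have "real n ^ 2 * card ?N * (2 * (real ?c - 1)) = real n ^ ?c * ?P * (2 * (real ?c - 1))"
      using eq by (simp only: mult.assoc)
    then show ?thesis using c2 by simp
  qed
qed

lemma power_split: "k \<le> m \<Longrightarrow> (x :: 'a :: monoid_mult) ^ m = x ^ k * x ^ (m - k)"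
  by (simp flip: power_add)

text \<open>Use \<open>k <= 2 ^ (k - 1)\<close> for each component; the exponents
  \<open>card C - 1\<close> add up to \<open>n - card (comps n S) = card S\<close>.\<close>

lemma prod_card_comps_le:
  assumes "forest n S"
  shows "(\<Prod>C\<in>comps n S. real (card C)) \<le> 2 ^ card S"
proof -
  have pos: "card C \<ge> 1" if "C \<in> comps n S" for C
    using comps_nonempty[OF that] finite_in_comps[OF that] by (simp add: Suc_le_eq card_gt_0_iff)
  have "real k \<le> 2 ^ (k - 1)" for k
  proof (cases k)
    case (Suc j)
    have "Suc j \<le> (2::nat) ^ j" by (rule Suc_leI[OF less_exp])
    then have "real (Suc j) \<le> real (2 ^ j)" by (rule of_nat_mono)
    then show ?thesis by (simp add: Suc)
  qed simp
  then have "(\<Prod>C\<in>comps n S. real (card C)) \<le> (\<Prod>C\<in>comps n S. 2 ^ (card C - 1))"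
    by (intro prod_mono) auto
  also have "\<dots> = 2 ^ (\<Sum>C\<in>comps n S. card C - 1)" by (simp add: power_sum)
  also have "(\<Sum>C\<in>comps n S. card C - 1) = (\<Sum>C\<in>comps n S. card C) - card (comps n S)"
    using pos by (subst sum_subtractf_nat) auto
  also have "(\<Sum>C\<in>comps n S. card C) = n" using sum_comps[of "\<lambda>_. 1::nat" n S] by simp
  also have "n - card (comps n S) = card S" using assms by (auto simp: forest_def)
  finally show ?thesis .
qed

lemma card_trees_containing_le:
  assumes n: "n \<ge> 2"
  shows "real (card (trees_containing n S)) \<le> (2 / n) ^ card S * real n ^ (n - 2)"
proof (cases "forest n S")
  case True
  let ?t = "real (card (trees_containing n S))"
  have c: "card (comps n S) = n - card S" "card S \<le> n" using True by (auto simp: forest_def)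
  have "real n ^ 2 * ?t \<le> real n ^ (n - card S) * 2 ^ card S"
    using card_trees_containing[OF _ True] n c(1) prod_card_comps_le[OF True]
    by (simp add: mult_left_mono)
  also have "\<dots> = real n ^ 2 * ((2 / n) ^ card S * real n ^ (n - 2))"
  proof -
    have "real n ^ (n - card S) * real n ^ card S = real n ^ 2 * real n ^ (n - 2)"
      using power_split[OF n, of "real n"] power_split[OF c(2), of "real n"] by (simp only: mult.commute)
    then show ?thesis using n by (simp add: power_divide field_simps)
  qed
  finally show ?thesis using n by simp
next
  case False
  then have "trees_containing n S = {}"
    using forest_subset spanning_tree_forest[of n] n
    by (fastforce simp: trees_containing_def spanning_trees_def)
  then show ?thesis by simp
qed

lemma card_trees_containing_edge:
  assumes n: "n \<ge> 3" and e: "e \<in> Kn_edges n"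
  shows "card (trees_containing n {e}) = 2 * n ^ (n - 3)"
proof -
  obtain u v where uv: "e = {u, v}" "u \<in> {1..n}" "v \<in> {1..n}" "u \<noteq> v" using e by (rule Kn_edgesE)
  have nc: "\<not> conn {} u v"
    using uv by (auto simp: adj_def elim: converse_rtranclpE)
  have "component n {} w = {w}" if "w \<in> {1..n}" for w
    using that by (auto simp: component_def adj_def elim: converse_rtranclpE)
  then have "(\<Prod>C\<in>comps n {e}. real (card C)) = (\<Prod>C\<in>comps n {}. real (card C)) * 2"
    using prod_comps_insert[OF uv(2,3) nc] uv by simp
  also have "(\<Prod>C\<in>comps n {}. real (card C)) = 1"
    by (intro prod.neutral) (auto simp: comps_empty)
  finally have P: "(\<Prod>C\<in>comps n {e}. real (card C)) = 2" by simp
  have fo: "forest n {e}" using forest_insert_iff[OF forest_empty uv(2,3)] nc uv by simp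
  then have "card (comps n {e}) = n - 1" by (auto simp: forest_def)
  then have "real n ^ 2 * card (trees_containing n {e}) = real n ^ (n - 1) * 2"
    using card_trees_containing[OF _ fo] n P by simp
  also have "real n ^ (n - 1) = real n ^ 2 * real n ^ (n - 3)"
    using power_split[of 2 "n - 1" "real n"] n by (simp add: numeral_3_eq_3 numeral_2_eq_2)
  finally have "real n ^ 2 * card (trees_containing n {e}) = real n ^ 2 * real (2 * n ^ (n - 3))"
    by (simp add: mult.commute)
  then have "real (card (trees_containing n {e})) = real (2 * n ^ (n - 3))" using n by simp
  then show ?thesis by (simp only: of_nat_eq_iff)
qed

section \<open>Stars and edge exchanges\<close>

definition star :: "nat \<Rightarrow> nat \<Rightarrow> nat set set" where
  "star n v = (\<lambda>w. {v, w}) ` ({1..n} - {v})"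

lemma card_star: "v \<in> {1..n} \<Longrightarrow> card (star n v) = n - 1"
  unfolding star_def by (subst card_image) (auto simp: inj_on_def doubleton_eq_iff)

lemma star_subset: "v \<in> {1..n} \<Longrightarrow> star n v \<subseteq> Kn_edges n"
  by (auto simp: star_def)

lemma spanning_tree_star:
  assumes "v \<in> {1..n}"
  shows "spanning_tree n (star n v)"
proof -
  have "conn (star n v) v w" if "w \<in> {1..n}" for w
    using that by (cases "w = v") (auto intro!: conn_edge simp: star_def)
  then have "connected_on n (star n v)"
    unfolding connected_on_def by (meson conn_sym rtranclp_trans)
  then show ?thesis
    using assms star_subset card_star by (simp add: spanning_tree_iff connected_on_iff)
qed

lemma spanning_tree_eq_if_subset:
  assumes "n \<ge> 1" "spanning_tree n S" "spanning_tree n T" "S \<subseteq> T"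
  shows "S = T"
proof (rule card_subset_eq[OF _ assms(4)])
  show "finite T" using forest_finite spanning_tree_forest[OF assms(1,3)] by blast
  show "card S = card T" using assms by (simp add: spanning_tree_iff)
qed

lemma is_star_iff: "is_star n T \<longleftrightarrow> (\<exists>v\<in>{1..n}. T = star n v)"
proof
  assume "is_star n T"
  then obtain v where T: "spanning_tree n T" and v: "v \<in> {1..n}" and d: "degree T v = n - 1"
    by (auto simp: is_star_def)
  have "{e \<in> T. v \<in> e} \<subseteq> star n v"
  proof
    fix e assume "e \<in> {e \<in> T. v \<in> e}"
    then have "e \<in> Kn_edges n" "v \<in> e" using T by (auto simp: spanning_tree_def)
    then show "e \<in> star n v" by (auto simp: star_def elim!: Kn_edgesE)
  qed
  then have "{e \<in> T. v \<in> e} = star n v"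
    using d card_star[OF v] by (intro card_subset_eq) (auto simp: degree_def star_def)
  then have "star n v \<subseteq> T" by auto
  then have "star n v = T" using v T spanning_tree_star[OF v] by (intro spanning_tree_eq_if_subset) auto
  then show "\<exists>v\<in>{1..n}. T = star n v" using v by auto
next
  assume "\<exists>v\<in>{1..n}. T = star n v"
  then obtain v where v: "v \<in> {1..n}" "T = star n v" by auto
  moreover have "{e \<in> star n v. v \<in> e} = star n v" by (auto simp: star_def)
  ultimately show "is_star n T" unfolding is_star_def degree_def
    using spanning_tree_star[OF v(1)] card_star[OF v(1)] by (metis v(1))
qed

lemma inj_on_star:
  assumes "n \<ge> 3"
  shows "inj_on (star n) {1..n}"
proof (rule inj_onI, rule ccontr)
  fix v w assume vw: "v \<in> {1..n}" "w \<in> {1..n}" "star n v = star n w" "v \<noteq> w"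
  have "card ({1..n} - {v, w}) > 0" using vw assms by (simp add: card_Diff_subset)
  then have "{1..n} - {v, w} \<noteq> {}" by (metis card.empty less_irrefl)
  then obtain x where x: "x \<in> {1..n}" "x \<noteq> v" "x \<noteq> w" by blast
  have "{v, x} \<in> star n v" using x by (auto simp: star_def)
  then have "{v, x} \<in> star n w" using vw(3) by simp
  then show False using x vw(4) by (auto simp: star_def doubleton_eq_iff)
qed

lemma stars_eq: "stars n = star n ` {1..n}"
  by (auto simp: stars_def is_star_iff)

lemma card_stars_avoiding:
  assumes n: "n \<ge> 3" and e: "e \<in> Kn_edges n"
  shows "card {T \<in> stars n. e \<notin> T} = n - 2"
proof -
  obtain a b where e: "e = {a, b}" "a \<in> {1..n}" "b \<in> {1..n}" "a \<noteq> b" using e by (rule Kn_edgesE)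
  have "e \<in> star n v \<longleftrightarrow> v \<in> {a, b}" if "v \<in> {1..n}" for v
    using e that by (auto simp: star_def doubleton_eq_iff)
  then have "{T \<in> stars n. e \<notin> T} = star n ` ({1..n} - {a, b})" by (auto simp: stars_eq)
  also have "card \<dots> = card ({1..n} - {a, b})"
    using inj_on_star[OF n] by (intro card_image) (rule inj_on_subset, auto)
  also have "\<dots> = n - 2" using e by (simp add: card_Diff_subset)
  finally show ?thesis .
qed

text \<open>Suppose all edges across the cut lie in \<open>T\<close>. Two vertices on each side
  would form a 4-cycle, so one side is a single vertex, and it is joined to all others:
  \<open>T\<close> is a star.\<close>

lemma cut_edge_outside_nonstar:
  assumes T: "spanning_tree n T" "\<not> is_star n T"
    and A: "A \<subseteq> {1..n}" "u \<in> A" "v \<in> {1..n} - A"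
  obtains a b where "a \<in> A" "b \<in> {1..n} - A" "{a, b} \<notin> T"
proof (rule ccontr)
  assume "\<not> thesis"
  then have all: "\<And>a b. a \<in> A \<Longrightarrow> b \<in> {1..n} - A \<Longrightarrow> {a, b} \<in> T" using that by blast
  have nostar: False if "w \<in> {1..n}" "\<And>x. x \<in> {1..n} - {w} \<Longrightarrow> {w, x} \<in> T" for w
  proof -
    have "star n w \<subseteq> T" unfolding star_def using that(2) by blast
    then have "star n w = T"
      using that(1) T spanning_tree_star by (intro spanning_tree_eq_if_subset) auto
    then show False using T(2) that(1) is_star_iff by blast
  qed
  show False
  proof (cases "\<exists>u'\<in>A. \<exists>v'\<in>{1..n} - A. u' \<noteq> u \<and> v' \<noteq> v")
    case True
    then obtain u' v' where uv: "u' \<in> A" "v' \<in> {1..n} - A" "u' \<noteq> u" "v' \<noteq> v" by blast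
    have ad: "adj T u v" "adj T v u'" "adj T u' v'" "adj T v' u"
      using all[OF A(2,3)] all[OF uv(1) A(3)] all[OF uv(1,2)] all[OF A(2) uv(2)] A uv
      by (auto simp: adj_def insert_commute)
    have "distinct [u, v, u', v']" using A uv by auto
    moreover have "adj T ([u, v, u', v'] ! i) ([u, v, u', v'] ! Suc i)" if "Suc i < 4" for i
    proof -
      from that consider "i = 0" | "i = 1" | "i = 2" by linarith
      then show ?thesis using ad by cases simp_all
    qed
    ultimately have "is_cycle T [u, v, u', v']" using ad(4) by (simp add: is_cycle_def)
    then show False using T by (auto simp: spanning_tree_def acyclic_graph_def)
  next
    case False
    have "A = {u} \<or> {1..n} - A = {v}"
    proof (cases "\<exists>u'\<in>A. u' \<noteq> u")
      case True
      then have "{1..n} - A \<subseteq> {v}" using False by blast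
      then show ?thesis using A(3) by blast
    next
      case False
      then show ?thesis using A(2) by blast
    qed
    then show False
    proof
      assume "A = {u}"
      then show False using A all by (intro nostar[of u]) auto
    next
      assume B: "{1..n} - A = {v}"
      show False
      proof (rule nostar[of v])
        fix x assume "x \<in> {1..n} - {v}"
        then have "x \<in> A" using B by blast
        then have "{x, v} \<in> T" by (rule all[OF _ A(3)])
        then show "{v, x} \<in> T" by (simp only: insert_commute[of v x])
      qed (use A in auto)
    qed
  qed
qed

lemma switch_edge:
  assumes n: "n \<ge> 1" and T: "spanning_tree n T" and T0: "spanning_tree n T0" "\<not> is_star n T0"
    and f: "f \<in> T \<inter> T0"
  shows "\<exists>T'. spanning_tree n T' \<and> T - T0 \<subseteq> T' \<and> T' \<inter> T0 = T \<inter> T0 - {f}"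
proof -
  have fo: "forest n T" by (rule spanning_tree_forest[OF n T])
  have "f \<in> Kn_edges n" using f T unfolding spanning_tree_def by blast
  then obtain u v where uv: "f = {u, v}" "u \<in> {1..n}" "v \<in> {1..n}" by (rule Kn_edgesE)
  let ?S = "T - {f}"
  have S: "forest n ?S" by (rule forest_subset[OF fo]) auto
  have ins: "insert {u, v} ?S = T" using f uv by auto
  have "\<not> conn ?S u v" using forest_insert_iff[OF S uv(2,3)] fo uv unfolding ins by simp
  then have "v \<in> {1..n} - component n ?S u" using uv(3) by (simp add: component_def)
  with T0 component_subset component_self[OF uv(2)]
  obtain a b where ab: "a \<in> component n ?S u" "b \<in> {1..n} - component n ?S u" "{a, b} \<notin> T0"
    by (rule cut_edge_outside_nonstar)
  have ua: "conn ?S u a" "\<not> conn ?S u b" using ab by (simp_all add: component_def)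
  have nab: "\<not> conn ?S a b"
  proof
    assume "conn ?S a b"
    with ua(1) have "conn ?S u b" by (rule rtranclp_trans)
    with ua(2) show False ..
  qed
  have notin: "{a, b} \<notin> ?S"
  proof
    assume "{a, b} \<in> ?S"
    then have "conn ?S a b" by (rule conn_edge)
    with nab show False ..
  qed
  have "a \<in> {1..n}" "b \<in> {1..n}" using ab by (auto simp: component_def)
  then have "forest n (insert {a, b} ?S)" using forest_insert_iff[OF S _ _ notin] nab by blast
  moreover have "card T = n - 1" using T by (simp add: spanning_tree_iff[OF n])
  then have "card (insert {a, b} ?S) = n - 1"
    using notin forest_finite[OF fo] card_Suc_Diff1[of T f] f by (subst card_insert_disjoint) auto
  ultimately have "spanning_tree n (insert {a, b} ?S)" by (rule spanning_treeI_forest[OF n])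
  moreover have "T - T0 \<subseteq> insert {a, b} ?S" using f by blast
  moreover have "insert {a, b} ?S \<inter> T0 = T \<inter> T0 - {f}" using ab(3) by blast
  ultimately show ?thesis by blast
qed

text \<open>Exchanges remove only edges of \<open>T0\<close>, so \<open>T - T0\<close> survives them
  all. This makes it possible to recover \<open>T\<close> from \<open>T'\<close> and a record of the
  edges gained and lost.\<close>

lemma switch_all_edges:
  assumes n: "n \<ge> 1" and T0: "spanning_tree n T0" "\<not> is_star n T0"
  shows "spanning_tree n T \<Longrightarrow> \<exists>T'. spanning_tree n T' \<and> T - T0 \<subseteq> T' \<and> T' \<inter> T0 = {}"
proof (induction "card (T \<inter> T0)" arbitrary: T rule: less_induct)
  case less
  show ?case
  proof (cases "T \<inter> T0 = {}")
    case False
    then obtain f where f: "f \<in> T \<inter> T0" by blast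
    obtain T1 where T1: "spanning_tree n T1" "T - T0 \<subseteq> T1" "T1 \<inter> T0 = T \<inter> T0 - {f}"
      using switch_edge[OF n less.prems T0 f] by blast
    have "finite (T \<inter> T0)" using forest_finite spanning_tree_forest[OF n less.prems] by blast
    then have lt: "card (T1 \<inter> T0) < card (T \<inter> T0)" unfolding T1(3) using f by (rule card_Diff1_less)
    then obtain T' where "spanning_tree n T'" "T1 - T0 \<subseteq> T'" "T' \<inter> T0 = {}"
      using less.hyps[OF lt T1(1)] by blast
    moreover from this have "T - T0 \<subseteq> T'" using T1(2) by blast
    ultimately show ?thesis by blast
  next
    case True
    then show ?thesis using less.prems by blast
  qed
qed

section \<open>Trees through \<open>e\<close> that nearly avoid a fixed tree\<close>

lemma card_subsets_le_3:
  assumes "finite A"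
  shows "card {X. X \<subseteq> A \<and> card X \<le> 3} \<le> (card A + 1) ^ 3"
proof -
  let ?m = "card A"
  have "{X. X \<subseteq> A \<and> card X \<le> 3} = (\<Union>k\<in>{..3}. {X. X \<subseteq> A \<and> card X = k})" by auto
  then have "card {X. X \<subseteq> A \<and> card X \<le> 3} \<le> (\<Sum>k\<le>3. card {X. X \<subseteq> A \<and> card X = k})"
    by (simp add: card_UN_le)
  also have "\<dots> = (\<Sum>k\<le>3. ?m choose k)" by (simp add: n_subsets[OF assms])
  also have "\<dots> \<le> (\<Sum>k\<le>3. ?m ^ k)"
  proof (rule sum_mono)
    show "?m choose k \<le> ?m ^ k" for k
      using binomial_le_pow[of k ?m] by (cases "k \<le> ?m") (auto simp: binomial_eq_0)
  qed
  also have "\<dots> = 1 + ?m + ?m ^ 2 + ?m ^ 3" by (simp add: atMost_nat_numeral)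
  also have "\<dots> \<le> (?m + 1) ^ 3" by (simp add: power2_eq_square power3_eq_cube algebra_simps)
  finally show ?thesis .
qed

text \<open>\<open>T\<close> is the switched tree without the gained edges and with the lost ones
  restored. Equally many are gained and lost, as both trees have \<open>n - 1\<close> edges, and an
  \<open>(n - 1)\<close>-set has at most \<open>n ^ 3\<close> subsets of size at most 3.\<close>

lemma card_near_disjoint_trees_le:
  assumes n: "n \<ge> 1" and T0: "spanning_tree n T0" "\<not> is_star n T0" and e: "e \<notin> T0"
  shows "card {T \<in> trees_containing n {e}. card (T \<inter> T0) \<le> 3}
    \<le> card {T \<in> trees_containing n {e}. T \<inter> T0 = {}} * n ^ 6"
proof -
  let ?P = "{T \<in> trees_containing n {e}. card (T \<inter> T0) \<le> 3}"
  let ?D = "{T \<in> trees_containing n {e}. T \<inter> T0 = {}}"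
  let ?sub = "\<lambda>A :: nat set set. {X. X \<subseteq> A \<and> card X \<le> 3}"
  have tree: "spanning_tree n T" if "T \<in> trees_containing n {e}" for T
    using that by (simp add: trees_containing_def spanning_trees_def)
  define sw where "sw T = (SOME T'. spanning_tree n T' \<and> T - T0 \<subseteq> T' \<and> T' \<inter> T0 = {})" for T
  have sw: "spanning_tree n (sw T) \<and> T - T0 \<subseteq> sw T \<and> sw T \<inter> T0 = {}" if "T \<in> ?P" for T
  proof -
    have "spanning_tree n T" using that tree by blast
    then show ?thesis unfolding sw_def by (rule someI_ex[OF switch_all_edges[OF n T0]])
  qed
  define \<phi> where "\<phi> T = (sw T, sw T - (T - T0), T \<inter> T0)" for T
  have fin: "finite T" "card T = n - 1" if "spanning_tree n T" for T
    using that forest_finite spanning_tree_forest[OF n that] by (auto simp: spanning_tree_iff[OF n])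
  have "inj_on \<phi> ?P"
  proof (rule inj_onI)
    fix T U assume TU: "T \<in> ?P" "U \<in> ?P" "\<phi> T = \<phi> U"
    have eq: "sw T = sw U" "sw T - (T - T0) = sw U - (U - T0)" "T \<inter> T0 = U \<inter> T0"
      using TU(3) unfolding \<phi>_def prod.inject by blast+
    have "T = sw T - (sw T - (T - T0)) \<union> T \<inter> T0" using sw[OF TU(1)] by blast
    also have "\<dots> = sw U - (sw U - (U - T0)) \<union> U \<inter> T0" unfolding eq(2,3) unfolding eq(1) ..
    also have "\<dots> = U" using sw[OF TU(2)] by blast
    finally show "T = U" .
  qed
  moreover have "\<phi> ` ?P \<subseteq> (SIGMA T': ?D. ?sub T' \<times> ?sub T0)"
  proof
    fix p assume "p \<in> \<phi> ` ?P"
    then obtain T where T: "T \<in> ?P" and p: "p = \<phi> T" by blast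
    have tree: "spanning_tree n T" "e \<in> T" using T by (simp_all add: trees_containing_def spanning_trees_def)
    have "card (sw T - (T - T0)) = card (sw T) - card (T - T0)"
      using sw[OF T] fin[OF tree(1)] by (intro card_Diff_subset) auto
    also have "card (sw T) = card T" using sw[OF T] fin tree(1) by simp
    also have "card T - card (T - T0) = card (T \<inter> T0)"
      using fin[OF tree(1)] card_Diff_subset_Int[of T T0] card_mono[of T "T \<inter> T0"] by simp
    finally have "card (sw T - (T - T0)) \<le> 3" using T by simp
    moreover have "sw T \<in> ?D" using sw[OF T] tree e by (auto simp: trees_containing_def spanning_trees_def)
    ultimately show "p \<in> (SIGMA T': ?D. ?sub T' \<times> ?sub T0)"
      using T unfolding p \<phi>_def by simp
  qed
  moreover have finsub: "finite (?sub T' \<times> ?sub T0)" if "spanning_tree n T'" for T'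
    using fin[OF that] fin[OF T0(1)] by simp
  have finD: "finite ?D" by simp
  have finsub': "finite (?sub T' \<times> ?sub T0)" if "T' \<in> ?D" for T' using finsub tree that by blast
  have "finite (SIGMA T': ?D. ?sub T' \<times> ?sub T0)"
    by (rule finite_SigmaI[OF finD finsub'])
  ultimately have "card ?P \<le> card (SIGMA T': ?D. ?sub T' \<times> ?sub T0)" by (rule card_inj_on_le)
  also have "\<dots> = (\<Sum>T'\<in>?D. card (?sub T' \<times> ?sub T0))"
    by (rule card_SigmaI[OF finD ballI[OF finsub']])
  also have "\<dots> \<le> (\<Sum>T'\<in>?D. n ^ 6)"
  proof (rule sum_mono)
    fix T' assume "T' \<in> ?D"
    then have T': "spanning_tree n T'" using tree by blast
    have "card (?sub T) \<le> n ^ 3" if "spanning_tree n T" for T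
      using card_subsets_le_3[OF fin(1)[OF that]] fin(2)[OF that] n by simp
    then have "card (?sub T') * card (?sub T0) \<le> n ^ 3 * n ^ 3" using T' T0(1) by (intro mult_mono) auto
    then show "card (?sub T' \<times> ?sub T0) \<le> n ^ 6" by (simp add: card_cartesian_product flip: power_add)
  qed
  finally show ?thesis by simp
qed

text \<open>A tree containing \<open>e\<close> shares fewer than two edges with \<open>T0\<close> on average, so a constant
  proportion of these trees is turned into trees disjoint from \<open>T0\<close> by at most three switches.\<close>
lemma card_disjoint_trees_gt:
  assumes n: "n \<ge> 9" and T0: "spanning_tree n T0" "\<not> is_star n T0"
    and e: "e \<in> Kn_edges n" "e \<notin> T0"
  shows "n ^ (n - 9) < card {T \<in> trees_containing n {e}. T \<inter> T0 = {}}"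
proof -
  let ?N = "trees_containing n {e}"
  let ?P = "{T \<in> ?N. card (T \<inter> T0) \<le> 3}"
  let ?D = "{T \<in> ?N. T \<inter> T0 = {}}"
  have n1: "n \<ge> 1" "n \<ge> 2" "n \<ge> 3" using n by auto
  have fin0: "finite T0" "card T0 = n - 1"
    using T0(1) forest_finite spanning_tree_forest[OF n1(1) T0(1)] by (auto simp: spanning_tree_iff[OF n1(1)])
  have two: "real (card {T \<in> ?N. f \<in> T}) \<le> 4 * real n ^ (n - 4)" if "f \<in> T0" for f
  proof -
    have ef: "e \<noteq> f" using e that by auto
    have "{T \<in> ?N. f \<in> T} = trees_containing n {e, f}" by (auto simp: trees_containing_def)
    moreover have "card {e, f} = 2" using ef by simp
    ultimately have "real (card {T \<in> ?N. f \<in> T}) \<le> (2 / n) ^ 2 * real n ^ (n - 2)"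
      using card_trees_containing_le[OF n1(2), of "{e, f}"] by metis
    also have "real n ^ (n - 2) = real n ^ 2 * real n ^ (n - 4)"
      using power_split[of 2 "n - 2" "real n"] n by simp
    finally show ?thesis using n by (simp add: power_divide)
  qed
  \<comment> \<open>Trees outside \<open>?P\<close> contain at least four edges of
    \<open>T0\<close>. There are fewer than \<open>4 n^(n-3)\<close> incidences, so these trees make
    up less than half of the \<open>2 n^(n-3)\<close> trees in \<open>?N\<close>.\<close>
  have "(\<Sum>T\<in>?N - ?P. 4) \<le> (\<Sum>T\<in>?N - ?P. card (T \<inter> T0))" by (intro sum_mono) auto
  also have "\<dots> \<le> (\<Sum>T\<in>?N. card {f \<in> T0. f \<in> T})" 
    by (rule order_trans[OF sum_mono2[of ?N]]) (auto simp: Int_def conj_commute)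
  also have "\<dots> = (\<Sum>f\<in>T0. card {T \<in> ?N. f \<in> T})"
    using fin0 sum.swap_restrict[of ?N T0 "\<lambda>_ _. 1::nat" "\<lambda>T f. f \<in> T"] by simp
  finally have "real (4 * card (?N - ?P)) \<le> real (\<Sum>f\<in>T0. card {T \<in> ?N. f \<in> T})"
    by (intro of_nat_mono) (simp add: mult.commute)
  also have "\<dots> \<le> (\<Sum>f\<in>T0. 4 * real n ^ (n - 4))"
    unfolding of_nat_sum by (rule sum_mono) (rule two)
  also have "\<dots> = 4 * (real (n - 1) * real n ^ (n - 4))" using fin0 by simp
  also have "\<dots> < 4 * (real n * real n ^ (n - 4))" using n by simp
  also have "real n * real n ^ (n - 4) = real n ^ (n - 3)"
    using power_split[of 1 "n - 3" "real n"] n by simp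
  finally have "real (card (?N - ?P)) < real (n ^ (n - 3))" by simp
  then have "card (?N - ?P) < n ^ (n - 3)" by (simp only: of_nat_less_iff)
  moreover have "card ?N = card ?P + card (?N - ?P)"
    using card_Un_disjoint[of ?P "?N - ?P"] by (simp add: Un_absorb1)
  ultimately have "n ^ (n - 3) < card ?P"
    using card_trees_containing_edge[OF n1(3) e(1)] by linarith
  also have "\<dots> \<le> card ?D * n ^ 6" by (rule card_near_disjoint_trees_le[OF n1(1) T0 e(2)])
  finally have "n ^ (n - 9) * n ^ 6 < card ?D * n ^ 6"
    using power_split[of 6 "n - 3" n] n by (simp add: mult.commute)
  then show ?thesis by simp
qed

section \<open>Intersecting families\<close>

lemma inj_on_Diff_superset: "inj_on (\<lambda>T. T - S) {T \<in> F. S \<subseteq> T}"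
  by (rule inj_onI) blast

text \<open>Choosing \<open>S\<close> to maximize \<open>|F(S)| r^|S|\<close> makes the link of \<open>S\<close> spread.\<close>
lemma spread_link_exists:
  assumes X: "finite X" "F \<subseteq> Pow X" and r: "r > 0"
  obtains S where "S \<subseteq> X" "real (card F) \<le> real (card {T \<in> F. S \<subseteq> T}) * r ^ card S"
    "spread r ((\<lambda>T. T - S) ` {T \<in> F. S \<subseteq> T})"
proof -
  define \<phi> where "\<phi> S = real (card {T \<in> F. S \<subseteq> T}) * r ^ card S" for S
  have finF: "finite F" using X by (meson finite_Pow_iff finite_subset)
  have "Max (\<phi> ` Pow X) \<in> \<phi> ` Pow X" using X by (intro Max_in) auto
  then obtain S where S: "S \<subseteq> X" "\<phi> S = Max (\<phi> ` Pow X)" by auto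
  have max: "\<phi> S' \<le> \<phi> S" if "S' \<subseteq> X" for S' unfolding S(2) using that X by (intro Max_ge) auto
  have finS: "finite S" using S(1) X(1) finite_subset by blast
  have "real (card F) \<le> \<phi> S" using max[of "{}"] by (simp add: \<phi>_def)
  moreover have "spread r ((\<lambda>T. T - S) ` {T \<in> F. S \<subseteq> T})"
    unfolding spread_def
  proof (intro allI impI)
    fix Y :: "'a set" assume Y: "finite Y"
    let ?L = "(\<lambda>T. T - S) ` {T \<in> F. S \<subseteq> T}"
    have cardL: "card ?L = card {T \<in> F. S \<subseteq> T}" by (rule card_image[OF inj_on_Diff_superset])
    show "real (card {T \<in> ?L. Y \<subseteq> T}) * r ^ card Y \<le> real (card ?L)"
    proof (cases "Y \<subseteq> X - S")
      case True
      have "{T \<in> ?L. Y \<subseteq> T} \<subseteq> (\<lambda>T. T - S) ` {T \<in> F. S \<union> Y \<subseteq> T}" by auto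
      then have "card {T \<in> ?L. Y \<subseteq> T} \<le> card ((\<lambda>T. T - S) ` {T \<in> F. S \<union> Y \<subseteq> T})"
        using finF by (intro card_mono) auto
      also have "\<dots> \<le> card {T \<in> F. S \<union> Y \<subseteq> T}" using finF by (intro card_image_le) auto
      finally have "real (card {T \<in> ?L. Y \<subseteq> T}) * r ^ card Y * r ^ card S
          \<le> real (card {T \<in> F. S \<union> Y \<subseteq> T}) * r ^ card Y * r ^ card S"
        using r by (intro mult_right_mono) auto
      also have "\<dots> = \<phi> (S \<union> Y)"
        using True finS Y by (subst \<phi>_def, subst card_Un_disjoint) (auto simp: power_add)
      also have "\<dots> \<le> \<phi> S" using True S by (intro max) auto
      finally show ?thesis using r by (simp add: \<phi>_def cardL)
    next
      case False
      then have "{T \<in> ?L. Y \<subseteq> T} = {}" using X(2) by auto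
      then show ?thesis by (simp only: card.empty)
    qed
  qed
  ultimately show thesis using that S(1) by (simp add: \<phi>_def)
qed

section \<open>The extremal argument, with \<open>r\<close> equal to
  \<open>2/3 sqrt n\<close>\<close>

context
  fixes n :: nat and r :: real
  assumes n: "n \<ge> 2 ^ 19" and r: "r > 0" "r\<^sup>2 = 4 / 9 * n"
begin

lemma r_ge: "r \<ge> 482"
proof -
  have "524288 \<le> n" using n by simp
  then have "524288 \<le> real n" by simp
  then have "482\<^sup>2 \<le> r\<^sup>2" unfolding r(2) by simp
  then show ?thesis by (rule power2_le_imp_le) (use r(1) in simp)
qed

lemma n_eq: "real n = 9 / 4 * r\<^sup>2"
  using r by simp

text \<open>The factor that each edge of \<open>S\<close> contributes to the counting bound
  multiplied by \<open>r ^ card S\<close>.\<close>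

lemma ratio_eq: "2 / n * r = 8 / (9 * r)"
  using r_ge by (simp add: n_eq power2_eq_square)

lemma ratio_power: "(2 / n) ^ k * r ^ k = (8 / (9 * r)) ^ k"
  by (simp only: ratio_eq flip: power_mult_distrib)

lemma n_ge: "n \<ge> 100"
  using n by simp

lemma card_spanning_tree_le:
  assumes T: "spanning_tree n T" "T' \<subseteq> T"
  shows "real (card T') \<le> 9 / 4 * r\<^sup>2"
proof -
  have n1: "1 \<le> n" using n_ge by simp
  have "card T' \<le> card T"
    by (rule card_mono[OF forest_finite[OF spanning_tree_forest[OF n1 T(1)]] T(2)])
  also have "\<dots> \<le> n" using T(1) unfolding spanning_tree_iff[OF n1] by simp
  finally show ?thesis unfolding n_eq[symmetric] by (rule of_nat_mono)
qed

lemma card_superset_le: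
  assumes "F \<subseteq> spanning_trees n"
  shows "real (card {T \<in> F. S \<subseteq> T}) \<le> (2 / n) ^ card S * real n ^ (n - 2)"
proof -
  have n2: "2 \<le> n" using n_ge by simp
  have "{T \<in> F. S \<subseteq> T} \<subseteq> trees_containing n S" using assms by (auto simp: trees_containing_def)
  then have "card {T \<in> F. S \<subseteq> T} \<le> card (trees_containing n S)" by (intro card_mono finite_trees_containing)
  then show ?thesis by (intro order_trans[OF of_nat_mono card_trees_containing_le[OF n2]])
qed

lemma spanning_trees_Pow: "spanning_trees n \<subseteq> Pow (Kn_edges n)"
  by (auto simp: spanning_trees_def spanning_tree_def)

lemma popular_edge_exists:
  assumes F: "F \<subseteq> spanning_trees n" "intersecting_1 F" and large: "2 / n * real n ^ (n - 2) \<le> real (card F)"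
  obtains e where "e \<in> Kn_edges n" "real (card F) \<le> r * real (card {T \<in> F. e \<in> T})"
proof -
  let ?N = "real n ^ (n - 2)"
  have N: "?N > 0" using n_ge by simp
  have FPow: "F \<subseteq> Pow (Kn_edges n)" using F(1) spanning_trees_Pow by blast
  then obtain S where S: "S \<subseteq> Kn_edges n" "real (card F) \<le> real (card {T \<in> F. S \<subseteq> T}) * r ^ card S"
    "spread r ((\<lambda>T. T - S) ` {T \<in> F. S \<subseteq> T})"
    by (rule spread_link_exists[OF finite_Kn_edges _ r(1)])
  have "0 < 2 / n * ?N" using N n_ge by simp
  then have "0 < real (card F)" using large by linarith
  then have "F \<noteq> {}" by auto
  have "S \<noteq> {}"
  proof
    assume "S = {}"
    then have "spread r F" using S(3) by simp
    have size: "real (card T) \<le> 9 / 4 * r\<^sup>2" if "T \<in> F" for T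
      using that F(1) by (intro card_spanning_tree_le[OF _ order_refl]) (auto simp: spanning_trees_def)
    obtain T U where "T \<in> F" "U \<in> F" "T \<inter> U = {}"
      by (rule spread_imp_disjoint_members[OF finite_Kn_edges r_ge FPow \<open>F \<noteq> {}\<close> \<open>spread r F\<close> size
            FPow \<open>F \<noteq> {}\<close> \<open>spread r F\<close> size])
    then show False using F(2) by (auto simp: intersecting_1_def)
  qed
  \<comment> \<open>Here \<open>r^2 < n / 2\<close> enters: \<open>2 / n\<close> is
    \<open>8 / (9 r^2)\<close>, while two edges leave only \<open>64 / (81 r^2)\<close>.\<close>
  have "card S < 2"
  proof (rule ccontr)
    assume "\<not> card S < 2"
    have "2 / n * ?N \<le> real (card {T \<in> F. S \<subseteq> T}) * r ^ card S" using large S(2) by simp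
    also have "\<dots> \<le> (2 / n) ^ card S * ?N * r ^ card S"
      using card_superset_le[OF F(1), of S] r(1) by (intro mult_right_mono) auto
    also have "\<dots> = (8 / (9 * r)) ^ card S * ?N" unfolding ratio_power[symmetric] by (simp only: mult_ac)
    also have "\<dots> \<le> (8 / (9 * r))\<^sup>2 * ?N"
      using \<open>\<not> card S < 2\<close> r_ge N by (intro mult_right_mono power_decreasing) auto
    finally have "2 / n \<le> (8 / (9 * r))\<^sup>2" by (rule mult_right_le_imp_le[OF _ N])
    then have "8 / (9 * r\<^sup>2) \<le> 64 / (81 * r\<^sup>2)"
      by (simp add: n_eq power_divide power_mult_distrib)
    then show False using r_ge by (simp add: divide_simps)
  qed
  moreover have "finite S" using S(1) finite_subset finite_Kn_edges by blast
  then have "card S \<noteq> 0" using \<open>S \<noteq> {}\<close> by simp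
  ultimately have "card S = 1" by linarith
  then obtain e where e: "S = {e}" by (auto simp: card_1_singleton_iff)
  have "e \<in> Kn_edges n" using S(1) unfolding e by blast
  then show thesis using S(2) that[of e] by (simp add: e mult.commute)
qed

lemma card_remainder_less:
  assumes F: "F \<subseteq> spanning_trees n" "intersecting_1 F" and large: "2 / n * real n ^ (n - 2) \<le> real (card F)"
    and e: "real (card F) \<le> r * real (card {T \<in> F. e \<in> T})"
  shows "card {T \<in> F. e \<notin> T} < n ^ (n - 9)"
proof (rule ccontr)
  let ?F1 = "{T \<in> F. e \<notin> T}"
  assume "\<not> card ?F1 < n ^ (n - 9)"
  then have "real (n ^ (n - 9)) \<le> real (card ?F1)" by (intro of_nat_mono) simp
  then have F1: "real n ^ (n - 9) \<le> real (card ?F1)" by simp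
  let ?N = "real n ^ (n - 2)"
  have N: "?N > 0" using n_ge by simp
  have finF: "finite F" using F(1) finite_subset finite_spanning_trees by blast
  have F1sub: "?F1 \<subseteq> spanning_trees n" using F by blast
  obtain S where S: "S \<subseteq> Kn_edges n" "real (card ?F1) \<le> real (card {T \<in> ?F1. S \<subseteq> T}) * r ^ card S"
    "spread r ((\<lambda>T. T - S) ` {T \<in> ?F1. S \<subseteq> T})"
    by (rule spread_link_exists[OF finite_Kn_edges order_trans[OF F1sub spanning_trees_Pow] r(1)])
  have finS: "finite S" using S(1) finite_subset finite_Kn_edges by blast
  have F1pos: "0 < real (card {T \<in> ?F1. S \<subseteq> T}) * r ^ card S"
    using F1 S(2) n_ge by (intro less_le_trans[OF _ order_trans[OF F1 S(2)]]) simp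
  have ne: "{T \<in> ?F1. S \<subseteq> T} \<noteq> {}"
  proof
    assume "{T \<in> ?F1. S \<subseteq> T} = {}"
    then have "card {T \<in> ?F1. S \<subseteq> T} = 0" by (simp only: card.empty)
    then show False using F1pos by (simp only: of_nat_0 mult_zero_left less_irrefl)
  qed
  \<comment> \<open>The counting bound exceeds \<open>n ^ (n - 9)\<close> by \<open>n ^ 7\<close>,
    which is of order \<open>r ^ 14\<close>. Sixteen factors \<open>8 / (9 r)\<close> overcome this
    and leave a constant over \<open>r^2\<close>.\<close>
  have "card S \<le> 15"
  proof (rule ccontr)
    assume "\<not> card S \<le> 15"
    have "real n ^ (n - 9) \<le> real (card {T \<in> ?F1. S \<subseteq> T}) * r ^ card S" by (rule order_trans[OF F1 S(2)])
    also have "\<dots> \<le> (2 / n) ^ card S * ?N * r ^ card S"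
      using card_superset_le[OF F1sub, of S] r(1) by (intro mult_right_mono) auto
    also have "\<dots> = (8 / (9 * r)) ^ card S * ?N" unfolding ratio_power[symmetric] by (simp only: mult_ac)
    also have "\<dots> \<le> (8 / (9 * r)) ^ 16 * ?N"
      using \<open>\<not> card S \<le> 15\<close> r_ge N by (intro mult_right_mono power_decreasing) auto
    also have "?N = real n ^ 7 * real n ^ (n - 9)" using power_split[of 7 "n - 2" "real n"] n_ge by simp
    finally have "1 * real n ^ (n - 9) \<le> ((8 / (9 * r)) ^ 16 * real n ^ 7) * real n ^ (n - 9)" by (simp only: mult_ac mult_1)
    then have "1 \<le> (8 / (9 * r)) ^ 16 * real n ^ 7"
      by (rule mult_right_le_imp_le) (use n_ge in simp)
    also have "\<dots> = (8 / 9) ^ 16 * (9 / 4) ^ 7 / r\<^sup>2"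
    proof -
      have r16: "r ^ 16 = r ^ 14 * r\<^sup>2" by (simp flip: power_add)
      have cancel: "a * y / (b * (y * z)) = a / (b * z)" if "y \<noteq> 0" for a b y z :: real
        using that by simp
      show ?thesis
        unfolding n_eq power_mult_distrib power_divide using r(1)
        by (simp flip: power_mult) (simp only: r16, rule cancel, simp)
    qed
    also have "\<dots> < 1"
    proof -
      have "482\<^sup>2 \<le> r\<^sup>2" using r_ge by (intro power_mono) auto
      moreover have "0 < r\<^sup>2" using r(1) by simp
      ultimately show ?thesis by (simp add: power_divide pos_divide_less_eq)
    qed
    finally show False by simp
  qed
  have eS: "e \<notin> S" using ne by blast
  \<comment> \<open>Members meeting \<open>S\<close> are discarded: from \<open>T - {e}\<close> and
    \<open>U - S\<close> being disjoint one can conclude \<open>T \<inter> U = {}\<close> only if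
    \<open>T\<close> also misses \<open>S\<close>.\<close>
  define f where "f = {T \<in> F. e \<in> T \<and> T \<inter> S = {}}"
  have finf: "finite f" using finF by (simp add: f_def)
  have f_large: "8 / (9 * r) * (2 / n) * ?N \<le> real (card f)"
  proof -
    have "{T \<in> F. e \<in> T} \<subseteq> f \<union> (\<Union>x\<in>S. trees_containing n {e, x})"
      using F by (auto simp: f_def trees_containing_def)
    then have "card {T \<in> F. e \<in> T} \<le> card (f \<union> (\<Union>x\<in>S. trees_containing n {e, x}))"
      using finf finS by (intro card_mono) auto
    also have "\<dots> \<le> card f + (\<Sum>x\<in>S. card (trees_containing n {e, x}))"
      by (rule order_trans[OF card_Un_le]) (simp add: card_UN_le[OF finS])
    finally have "real (card {T \<in> F. e \<in> T}) \<le> real (card f) + (\<Sum>x\<in>S. real (card (trees_containing n {e, x})))"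
      unfolding of_nat_sum[symmetric] of_nat_add[symmetric] by (rule of_nat_mono)
    also have "(\<Sum>x\<in>S. real (card (trees_containing n {e, x}))) \<le> (\<Sum>x\<in>S. (2 / n)\<^sup>2 * ?N)"
    proof (rule sum_mono)
      fix x assume "x \<in> S"
      then have "e \<noteq> x" using eS by blast
      then have "card {e, x} = 2" by simp
      then show "real (card (trees_containing n {e, x})) \<le> (2 / n)\<^sup>2 * ?N"
        using card_trees_containing_le[of n "{e, x}"] n_ge by simp
    qed
    also have "\<dots> \<le> 15 * ((2 / n)\<^sup>2 * ?N)"
      using \<open>card S \<le> 15\<close> by (simp add: mult_right_mono)
    finally have 1: "real (card {T \<in> F. e \<in> T}) \<le> real (card f) + 15 * ((2 / n)\<^sup>2 * ?N)" by simp
    have "2 / n * ?N \<le> r * real (card {T \<in> F. e \<in> T})" using large e by simp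
    then have "1 / r * (2 / n * ?N) \<le> 1 / r * (r * real (card {T \<in> F. e \<in> T}))"
      using r(1) by (intro mult_left_mono) auto
    then have 2: "1 / r * (2 / n * ?N) \<le> real (card {T \<in> F. e \<in> T})"
      using r(1) by simp
    \<comment> \<open>Discarding costs at most 15 times \<open>(2 / n)^2\<close>, that is
      \<open>30 / n\<close> relative to \<open>2 / n\<close>. It fits into the gap between
      \<open>8 / (9 r)\<close> and \<open>1 / r\<close> as soon as \<open>r >= 120\<close>.\<close>
    have "8 / (9 * r) + 30 / n = (8 * r + 120) / (9 * r\<^sup>2)"
      using r(1) by (simp add: n_eq field_simps power2_eq_square)
    also have "\<dots> \<le> (9 * r) / (9 * r\<^sup>2)" using r_ge by (intro divide_right_mono) auto
    also have "\<dots> = 1 / r" using r(1) by (simp add: power2_eq_square)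
    finally have "(8 / (9 * r) + 30 / n) * (2 / n * ?N) \<le> 1 / r * (2 / n * ?N)"
      using N by (intro mult_right_mono) auto
    moreover have "30 / n * (2 / n * ?N) = 15 * ((2 / n)\<^sup>2 * ?N)" by (simp add: power2_eq_square)
    ultimately show ?thesis using 1 2 unfolding distrib_right mult.assoc by linarith
  qed
  let ?A = "(\<lambda>T. T - {e}) ` f"
  have cardA: "card ?A = card f"
    by (rule card_image, rule inj_onI) (auto simp: f_def)
  have A3: "spread r ?A"
    unfolding spread_def
  proof (intro allI impI)
    fix Y :: "nat set set" assume Y: "finite Y"
    show "real (card {T \<in> ?A. Y \<subseteq> T}) * r ^ card Y \<le> real (card ?A)"
    proof (cases "e \<in> Y \<or> Y = {}")
      case True
      then consider "Y = {}" | "{T \<in> ?A. Y \<subseteq> T} = {}" by auto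
      then show ?thesis
      proof cases
        case 2
        then show ?thesis by (simp only: card.empty)
      qed simp
    next
      case False
      have "{T \<in> ?A. Y \<subseteq> T} \<subseteq> (\<lambda>T. T - {e}) ` {T \<in> F. insert e Y \<subseteq> T}" by (auto simp: f_def)
      then have "card {T \<in> ?A. Y \<subseteq> T} \<le> card ((\<lambda>T. T - {e}) ` {T \<in> F. insert e Y \<subseteq> T})"
        using finF by (intro card_mono) auto
      also have "\<dots> \<le> card {T \<in> F. insert e Y \<subseteq> T}" using finF by (intro card_image_le) auto
      finally have "real (card {T \<in> ?A. Y \<subseteq> T}) \<le> real (card {T \<in> F. insert e Y \<subseteq> T})" by simp
      also have "\<dots> \<le> (2 / n) ^ card (insert e Y) * ?N" by (rule card_superset_le[OF F(1)])
      also have "card (insert e Y) = Suc (card Y)" using False Y by simp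
      finally have "real (card {T \<in> ?A. Y \<subseteq> T}) * r ^ card Y \<le> (2 / n) ^ Suc (card Y) * ?N * r ^ card Y"
        using r(1) by (intro mult_right_mono) auto
      also have "\<dots> = (8 / (9 * r)) ^ card Y * (2 / n * ?N)"
        unfolding ratio_power[symmetric] by (simp only: power_Suc mult_ac)
      also have "\<dots> \<le> (8 / (9 * r)) ^ 1 * (2 / n * ?N)"
        using False Y r_ge N by (intro mult_right_mono power_decreasing) (auto simp: Suc_le_eq card_gt_0_iff)
      also have "\<dots> \<le> real (card ?A)" using f_large cardA by simp
      finally show ?thesis .
    qed
  qed
  have A2: "?A \<noteq> {}"
  proof -
    have "0 < 8 / (9 * r) * (2 / n) * ?N" using r_ge n_ge N by simp
    then have "0 < real (card f)" using f_large by linarith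
    then show ?thesis by auto
  qed
  have A1: "?A \<subseteq> Pow (Kn_edges n)" using F(1) spanning_trees_Pow by (fastforce simp: f_def)
  have A4: "real (card T) \<le> 9 / 4 * r\<^sup>2" if TA: "T \<in> ?A" for T
  proof -
    obtain T1 where "T1 \<in> f" "T = T1 - {e}" using TA by blast
    then show ?thesis using F(1) by (intro card_spanning_tree_le[of T1]) (auto simp: f_def spanning_trees_def)
  qed
  let ?B = "(\<lambda>T. T - S) ` {T \<in> ?F1. S \<subseteq> T}"
  have B2: "?B \<noteq> {}" using ne by blast
  have B1: "?B \<subseteq> Pow (Kn_edges n)" using F(1) spanning_trees_Pow by fastforce
  have B4: "real (card T) \<le> 9 / 4 * r\<^sup>2" if TB: "T \<in> ?B" for T
  proof -
    obtain T1 where "T1 \<in> F" "T = T1 - S" using TB by blast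
    then show ?thesis using F(1) by (intro card_spanning_tree_le[of T1]) (auto simp: spanning_trees_def)
  qed
  obtain T' U' where TU': "T' \<in> ?A" "U' \<in> ?B" "T' \<inter> U' = {}"
    by (rule spread_imp_disjoint_members[OF finite_Kn_edges r_ge A1 A2 A3 A4 B1 B2 S(3) B4])
  then obtain T U where "T \<in> f" "T' = T - {e}" "U \<in> ?F1" "S \<subseteq> U" "U' = U - S" by blast
  then have "T \<in> F" "U \<in> F" "T \<inter> U = {}" using TU'(3) by (auto simp: f_def)
  then show False using F(2) by (auto simp: intersecting_1_def)
qed

lemma large_intersecting_family:
  assumes F: "F \<subseteq> spanning_trees n" "intersecting_1 F" and large: "2 * n ^ (n - 3) + (n - 2) \<le> card F"
  shows "\<exists>e\<in>Kn_edges n. F = stars n \<union> {T \<in> spanning_trees n. e \<in> T}"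
proof -
  have n3: "n \<ge> 3" "n \<ge> 9" using n_ge by auto
  have N: "2 / n * real n ^ (n - 2) = real (2 * n ^ (n - 3))"
    using power_split[of 1 "n - 2" "real n"] n_ge by simp
  have "2 / n * real n ^ (n - 2) \<le> real (card F)" unfolding N using large by (intro of_nat_mono) simp
  then obtain e where e: "e \<in> Kn_edges n" and rem: "card {T \<in> F. e \<notin> T} < n ^ (n - 9)"
    using popular_edge_exists[OF F] card_remainder_less[OF F] by blast
  have finF: "finite F" using F(1) finite_subset finite_spanning_trees by blast
  have "card F = card ({T \<in> F. e \<in> T} \<union> {T \<in> F. e \<notin> T})" by (rule arg_cong[of _ _ card]) blast
  also have "\<dots> = card {T \<in> F. e \<in> T} + card {T \<in> F. e \<notin> T}"
    using finF by (intro card_Un_disjoint) auto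
  finally have split: "card F = card {T \<in> F. e \<in> T} + card {T \<in> F. e \<notin> T}" .
  let ?N = "trees_containing n {e}"
  have sub: "{T \<in> F. e \<in> T} \<subseteq> ?N" using F(1) by (auto simp: trees_containing_def)
  have cN: "card ?N = 2 * n ^ (n - 3)" by (rule card_trees_containing_edge[OF n3(1) e])
  have stars: "{T \<in> F. e \<notin> T} \<subseteq> {T \<in> stars n. e \<notin> T}"
  proof (rule subsetI, rule ccontr)
    fix T0 assume T0: "T0 \<in> {T \<in> F. e \<notin> T}" "T0 \<notin> {T \<in> stars n. e \<notin> T}"
    let ?D = "{T \<in> ?N. T \<inter> T0 = {}}"
    have "n ^ (n - 9) < card ?D"
      using T0 F(1) by (intro card_disjoint_trees_gt[OF n3(2) _ _ e]) (auto simp: spanning_trees_def stars_def)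
    moreover have "{T \<in> F. e \<in> T} \<inter> ?D = {}" using F(2) T0 by (auto simp: intersecting_1_def)
    then have "card {T \<in> F. e \<in> T} + card ?D \<le> card ?N"
    proof (subst card_Un_disjoint[symmetric])
      show "card ({T \<in> F. e \<in> T} \<union> ?D) \<le> card ?N" using sub by (intro card_mono) auto
    qed (use finF in auto)
    ultimately show False using split rem cN large by linarith
  qed
  have finst: "finite {T \<in> stars n. e \<notin> T}" by (simp add: stars_eq)
  have cst: "card {T \<in> stars n. e \<notin> T} = n - 2" by (rule card_stars_avoiding[OF n3(1) e])
  have "card {T \<in> F. e \<in> T} \<le> card ?N" by (rule card_mono[OF finite_trees_containing sub])
  moreover have "card {T \<in> F. e \<notin> T} \<le> card {T \<in> stars n. e \<notin> T}" by (rule card_mono[OF finst stars])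
  ultimately have "card {T \<in> F. e \<in> T} = card ?N" "card {T \<in> F. e \<notin> T} = card {T \<in> stars n. e \<notin> T}"
    using large split cN cst by linarith+
  then have "{T \<in> F. e \<in> T} = ?N" "{T \<in> F. e \<notin> T} = {T \<in> stars n. e \<notin> T}"
    using card_subset_eq[OF finite_trees_containing sub] card_subset_eq[OF finst stars] by blast+
  then have "F = ?N \<union> {T \<in> stars n. e \<notin> T}" by blast
  also have "\<dots> = stars n \<union> {T \<in> spanning_trees n. e \<in> T}"
    by (auto simp: trees_containing_def stars_def is_star_def spanning_trees_def)
  finally have "F = stars n \<union> {T \<in> spanning_trees n. e \<in> T}" .
  then show ?thesis using e by blast
qed

end

text \<open>Two of the \<open>n\<close> stars contain \<open>e\<close> and are already counted among
  the trees through \<open>e\<close>.\<close>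

lemma card_stars_Un_edge_trees:
  assumes n: "n \<ge> 3" and e: "e \<in> Kn_edges n"
  shows "card (stars n \<union> {T \<in> spanning_trees n. e \<in> T}) = 2 * n ^ (n - 3) + (n - 2)"
proof -
  have "stars n \<union> {T \<in> spanning_trees n. e \<in> T} = trees_containing n {e} \<union> {T \<in> stars n. e \<notin> T}"
    by (auto simp: trees_containing_def stars_def is_star_def spanning_trees_def)
  also have "card \<dots> = card (trees_containing n {e}) + card {T \<in> stars n. e \<notin> T}"
    by (intro card_Un_disjoint) (auto simp: trees_containing_def stars_eq)
  finally show ?thesis
    using card_trees_containing_edge[OF n e] card_stars_avoiding[OF n e] by simp
qed

theorem theorem1p5:
  fixes n :: nat and F :: "nat set set set"
  assumes "n \<ge> 2 ^ 19"
    and "F \<subseteq> spanning_trees n"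
    and "intersecting_1 F"
  shows "card F \<le> 2 * n ^ (n - 3) + (n - 2)
    \<and> (card F = 2 * n ^ (n - 3) + (n - 2) \<longleftrightarrow>
         (\<exists>e\<in>Kn_edges n. F = stars n \<union> {T \<in> spanning_trees n. e \<in> T}))"
proof -
  let ?M = "2 * n ^ (n - 3) + (n - 2)"
  have n3: "n \<ge> 3" and "n > 0" using assms(1) by auto
  define r where "r = sqrt (4 / 9 * n)"
  have r: "r > 0" "r\<^sup>2 = 4 / 9 * n" using \<open>n > 0\<close> by (simp_all add: r_def)
  have ex: "\<exists>e\<in>Kn_edges n. F = stars n \<union> {T \<in> spanning_trees n. e \<in> T}" if "?M \<le> card F"
    by (rule large_intersecting_family[OF assms(1) r assms(2,3) that])
  have eq: "card F = ?M" if "\<exists>e\<in>Kn_edges n. F = stars n \<union> {T \<in> spanning_trees n. e \<in> T}"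
    using that card_stars_Un_edge_trees[OF n3] by blast
  show ?thesis
  proof (intro conjI iffI)
    show "card F \<le> ?M"
    proof (rule ccontr)
      assume "\<not> card F \<le> ?M"
      then show False using eq[OF ex] by linarith
    qed
    show "\<exists>e\<in>Kn_edges n. F = stars n \<union> {T \<in> spanning_trees n. e \<in> T}" if "card F = ?M"
      by (rule ex) (simp only: that order_refl)
    show "card F = ?M" if "\<exists>e\<in>Kn_edges n. F = stars n \<union> {T \<in> spanning_trees n. e \<in> T}"
      by (rule eq[OF that])
  qed
qed

end
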